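(* Let $U$ be a smooth affine variety over $\mathbf{C}$. Then the Lie algebra of vector fields $\mathrm{Vect}(U)=H^0(U,T_U)$, equipped with the commutator bracket, is finitely generated as a Lie algebra over $\mathbf{C}$.
   Context: $T_U$ denotes the tangent sheaf of $U$; equivalently $\mathrm{Vect}(U)=\mathrm{Der}_{\mathbf{C}}(\mathcal{O}(U))$ with the commutator bracket of derivations. *)

theory Defs
  imports "HOL-Analysis.Analysis"
begin

text \<open>
  Affine varieties are irreducible Zariski closed subsets of affine space \<open>\<complex>\<^sup>n\<close>. As the field is
  infinite, a polynomial in \<open>n\<close> variables is the same thing as the function it induces, and its
  formal partial derivatives are its complex partial derivatives.
\<close>

inductive_set polyfuns :: "(complex ^ 'n \<Rightarrow> complex) set" where
  const: "(\<lambda>x. c) \<in> polyfuns"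
| coord: "(\<lambda>x. x $ i) \<in> polyfuns"
| add: "f \<in> polyfuns \<Longrightarrow> g \<in> polyfuns \<Longrightarrow> (\<lambda>x. f x + g x) \<in> polyfuns"
| mult: "f \<in> polyfuns \<Longrightarrow> g \<in> polyfuns \<Longrightarrow> (\<lambda>x. f x * g x) \<in> polyfuns"

definition zariski_closed :: "(complex ^ 'n) set \<Rightarrow> bool" where
  "zariski_closed U \<longleftrightarrow> (\<exists>F \<subseteq> polyfuns. U = {x. \<forall>f\<in>F. f x = 0})"

definition irreducible_closed :: "(complex ^ 'n) set \<Rightarrow> bool" where
  "irreducible_closed U \<longleftrightarrow> zariski_closed U \<and> U \<noteq> {} \<and>
     (\<forall>Y Z. zariski_closed Y \<and> zariski_closed Z \<and> U = Y \<union> Z \<longrightarrow> U = Y \<or> U = Z)"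

definition affine_variety :: "(complex ^ 'n) set \<Rightarrow> bool" where
  "affine_variety U \<longleftrightarrow> irreducible_closed U"

definition zariski_dim :: "(complex ^ 'n) set \<Rightarrow> enat" where
  "zariski_dim U = Sup {enat d | d. \<exists>Z :: nat \<Rightarrow> (complex ^ 'n) set.
     (\<forall>i\<le>d. irreducible_closed (Z i) \<and> Z i \<subseteq> U) \<and> (\<forall>i<d. Z i \<subset> Z (Suc i))}"

definition vanishing_ideal :: "(complex ^ 'n) set \<Rightarrow> (complex ^ 'n \<Rightarrow> complex) set" where
  "vanishing_ideal U = {f \<in> polyfuns. \<forall>x\<in>U. f x = 0}"

definition gradient :: "(complex ^ 'n \<Rightarrow> complex) \<Rightarrow> complex ^ 'n \<Rightarrow> complex ^ 'n" where
  "gradient f x = (\<chi> j. deriv (\<lambda>t. f (x + axis j t)) 0)"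

text \<open>
  The rank at \<open>x\<close> of the Jacobian matrix of the equations of \<open>U\<close>. The rows run over the whole
  ideal of \<open>U\<close>; for \<open>x \<in> U\<close> the rows of any generating set of the ideal span the same space.
\<close>

definition jacobian_rank :: "(complex ^ 'n) set \<Rightarrow> complex ^ 'n \<Rightarrow> nat" where
  "jacobian_rank U x = vec.dim ((\<lambda>f. gradient f x) ` vanishing_ideal U)"

text \<open>The Jacobian criterion: the rank is \<open>n - dim U\<close> at every point of \<open>U\<close>.\<close>

definition smooth_variety :: "(complex ^ 'n) set \<Rightarrow> bool" where
  "smooth_variety U \<longleftrightarrow>
     (\<forall>x\<in>U. enat (jacobian_rank U x) + zariski_dim U = enat CARD('n))"

text \<open>
  A regular function on \<open>U\<close> is represented by its extension by zero to \<open>\<complex>\<^sup>n\<close>, so that the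
  operations of the ring \<open>\<O>(U)\<close> are the pointwise ones and equality is equality on \<open>U\<close>.
\<close>

definition coord_ring :: "(complex ^ 'n) set \<Rightarrow> (complex ^ 'n \<Rightarrow> complex) set" where
  "coord_ring U = (\<lambda>f x. if x \<in> U then f x else 0) ` polyfuns"

text \<open>
  The \<open>\<complex>\<close>-linear derivations of \<open>\<O>(U)\<close>. The first conjunct only fixes a junk value outside
  \<open>\<O>(U)\<close>, so that each derivation is represented by exactly one function.
\<close>

definition vector_fields ::
    "(complex ^ 'n) set \<Rightarrow> ((complex ^ 'n \<Rightarrow> complex) \<Rightarrow> complex ^ 'n \<Rightarrow> complex) set" where
  "vector_fields U = {D.
     (\<forall>f. f \<notin> coord_ring U \<longrightarrow> D f = (\<lambda>x. 0)) \<and>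
     (\<forall>f\<in>coord_ring U. D f \<in> coord_ring U) \<and>
     (\<forall>f\<in>coord_ring U. \<forall>g\<in>coord_ring U. D (\<lambda>x. f x + g x) = (\<lambda>x. D f x + D g x)) \<and>
     (\<forall>c. \<forall>f\<in>coord_ring U. D (\<lambda>x. c * f x) = (\<lambda>x. c * D f x)) \<and>
     (\<forall>f\<in>coord_ring U. \<forall>g\<in>coord_ring U. D (\<lambda>x. f x * g x) = (\<lambda>x. f x * D g x + g x * D f x))}"

definition lie_bracket ::
    "(('a \<Rightarrow> complex) \<Rightarrow> 'a \<Rightarrow> complex) \<Rightarrow> (('a \<Rightarrow> complex) \<Rightarrow> 'a \<Rightarrow> complex)
      \<Rightarrow> ('a \<Rightarrow> complex) \<Rightarrow> 'a \<Rightarrow> complex" where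
  "lie_bracket D E = (\<lambda>f x. D (E f) x - E (D f) x)"

definition lie_closed :: "(('a \<Rightarrow> complex) \<Rightarrow> 'a \<Rightarrow> complex) set \<Rightarrow> bool" where
  "lie_closed L \<longleftrightarrow>
     (\<lambda>f x. 0) \<in> L \<and>
     (\<forall>D\<in>L. \<forall>E\<in>L. (\<lambda>f x. D f x + E f x) \<in> L) \<and>
     (\<forall>c. \<forall>D\<in>L. (\<lambda>f x. c * D f x) \<in> L) \<and>
     (\<forall>D\<in>L. \<forall>E\<in>L. lie_bracket D E \<in> L)"

text \<open>
  \<open>lie_closed hull S\<close> is the smallest complex subspace closed under the bracket that contains \<open>S\<close>.
\<close>

definition finitely_generated_lie :: "(('a \<Rightarrow> complex) \<Rightarrow> 'a \<Rightarrow> complex) set \<Rightarrow> bool" where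
  "finitely_generated_lie L \<longleftrightarrow> (\<exists>S. finite S \<and> S \<subseteq> L \<and> lie_closed hull S = L)"

lemma coord_ring_zero: "(\<lambda>x. 0) \<in> coord_ring U"
  unfolding coord_ring_def by (rule image_eqI[OF _ polyfuns.const[of 0]]) auto

lemma coord_ring_add:
  assumes "f \<in> coord_ring U" "g \<in> coord_ring U"
  shows "(\<lambda>x. f x + g x) \<in> coord_ring U"
proof -
  obtain p q where "p \<in> polyfuns" "q \<in> polyfuns"
    "f = (\<lambda>x. if x \<in> U then p x else 0)" "g = (\<lambda>x. if x \<in> U then q x else 0)"
    using assms unfolding coord_ring_def by blast
  then show ?thesis
    unfolding coord_ring_def by (intro image_eqI[OF _ polyfuns.add[of p q]]) auto
qed

lemma coord_ring_mult:
  assumes "f \<in> coord_ring U" "g \<in> coord_ring U"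
  shows "(\<lambda>x. f x * g x) \<in> coord_ring U"
proof -
  obtain p q where "p \<in> polyfuns" "q \<in> polyfuns"
    "f = (\<lambda>x. if x \<in> U then p x else 0)" "g = (\<lambda>x. if x \<in> U then q x else 0)"
    using assms unfolding coord_ring_def by blast
  then show ?thesis
    unfolding coord_ring_def by (intro image_eqI[OF _ polyfuns.mult[of p q]]) auto
qed

lemma coord_ring_scale:
  assumes "f \<in> coord_ring U"
  shows "(\<lambda>x. c * f x) \<in> coord_ring U"
proof -
  obtain p where "p \<in> polyfuns" "f = (\<lambda>x. if x \<in> U then p x else 0)"
    using assms unfolding coord_ring_def by blast
  then show ?thesis
    unfolding coord_ring_def
    by (intro image_eqI[OF _ polyfuns.mult[OF polyfuns.const[of c], of p]]) auto
qed

lemma coord_ring_diff: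
  assumes "f \<in> coord_ring U" "g \<in> coord_ring U"
  shows "(\<lambda>x. f x - g x) \<in> coord_ring U"
  using coord_ring_add[OF assms(1) coord_ring_scale[OF assms(2), of "-1"]] by simp

lemma vector_fields_D:
  assumes "D \<in> vector_fields U"
  shows "f \<notin> coord_ring U \<Longrightarrow> D f = (\<lambda>x. 0)"
    and "f \<in> coord_ring U \<Longrightarrow> D f \<in> coord_ring U"
    and "f \<in> coord_ring U \<Longrightarrow> g \<in> coord_ring U \<Longrightarrow> D (\<lambda>x. f x + g x) = (\<lambda>x. D f x + D g x)"
    and "f \<in> coord_ring U \<Longrightarrow> D (\<lambda>x. c * f x) = (\<lambda>x. c * D f x)"
    and "f \<in> coord_ring U \<Longrightarrow> g \<in> coord_ring U \<Longrightarrow>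
      D (\<lambda>x. f x * g x) = (\<lambda>x. f x * D g x + g x * D f x)"
  using assms unfolding vector_fields_def by simp_all

lemma vector_fields_zero:
  assumes "D \<in> vector_fields U"
  shows "D (\<lambda>x. 0) = (\<lambda>x. 0)"
  using vector_fields_D(4)[OF assms coord_ring_zero, of 0] by simp

lemma lie_closed_vector_fields: "lie_closed (vector_fields U)"
  unfolding lie_closed_def
proof (intro conjI allI ballI)
  show "(\<lambda>f x. 0) \<in> vector_fields U"
    by (simp add: vector_fields_def coord_ring_zero)
next
  fix D E assume "D \<in> vector_fields U" "E \<in> vector_fields U"
  note DE = this[THEN vector_fields_D(1)] this[THEN vector_fields_D(2)]
    this[THEN vector_fields_D(3)] this[THEN vector_fields_D(4)] this[THEN vector_fields_D(5)]
  show "(\<lambda>f x. D f x + E f x) \<in> vector_fields U"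
    unfolding vector_fields_def
    by (auto simp: DE coord_ring_add algebra_simps)
next
  fix c D assume D: "D \<in> vector_fields U"
  show "(\<lambda>f x. c * D f x) \<in> vector_fields U"
    unfolding vector_fields_def
    by (auto simp: vector_fields_D[OF D] coord_ring_scale algebra_simps)
next
  fix D E assume asm: "D \<in> vector_fields U" "E \<in> vector_fields U"
  note DE = asm[THEN vector_fields_D(1)] asm[THEN vector_fields_D(2)]
    asm[THEN vector_fields_D(3)] asm[THEN vector_fields_D(4)] asm[THEN vector_fields_D(5)]
    asm[THEN vector_fields_zero]
  show "lie_bracket D E \<in> vector_fields U"
    unfolding vector_fields_def lie_bracket_def
    by (auto simp: DE coord_ring_diff coord_ring_add coord_ring_mult coord_ring_scale algebra_simps)
qed

end

theory Submission
  imports Defs "HOL-Library.Function_Algebras" "HOL-Computational_Algebra.Fundamental_Theorem_Algebra"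
begin

text \<open>
  Write \<open>A = \<O>(U)\<close> and \<open>V\<close> for the \<open>A\<close>-module of vector fields. For a vector field \<open>P\<close> and functions \<open>u, v, a\<close>,

    \<open>[u a P, v P] - [u P, v a P] = - 2 u v P(a) P\<close>,

  and the right-hand side contains no derivatives of \<open>u\<close> and \<open>v\<close>. Suppose that \<open>V\<close> is generated as an
  \<open>A\<close>-module by finitely many fields \<open>P(a) P\<close>. Writing each \<open>P\<close> itself as a combination of these generators,
  the identity produces every multiple \<open>u v P\<close> from brackets of multiples \<open>w Q\<close> in which the degree of \<open>w\<close>
  exceeds those of \<open>u\<close> and \<open>v\<close> by a constant only. A function of high degree is a sum of products of
  functions of about half the degree. Hence the multiples of the \<open>P\<close> of some bounded degree generate all
  multiples of the next degree, then of the following one, and finally all of \<open>V\<close>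
  (\<open>finitely_generated_if_square_span\<close>).

  Smoothness provides the generators. Near a point \<open>p\<close> of \<open>U\<close>, choose equations of \<open>U\<close> whose gradients at
  \<open>p\<close> are a basis of the row space of the Jacobian, and complete them by linear forms \<open>a\<^sub>k\<close> to a frame with
  determinant \<open>\<delta>\<close>. Determinants with one row replaced by the gradient of the argument define derivations
  \<open>P\<^sub>k\<close>; as the Jacobian has the same rank at all points of \<open>U\<close>, they are tangent to \<open>U\<close>. They satisfy
  \<open>P\<^sub>k(a\<^sub>k) = \<delta>\<close>, and Cramer's rule yields \<open>\<delta>\<^sup>2 X = \<Sum> X(a\<^sub>k) P\<^sub>k(a\<^sub>k) P\<^sub>k\<close> for every vector field \<open>X\<close>
  (\<open>local_square_span\<close>).

  The functions \<open>\<delta>\<^sup>2\<close> for the various points \<open>p\<close> have no common zero on \<open>U\<close>, so by the weak Nullstellensatz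
  finitely many of them generate the unit ideal of \<open>A\<close>, and the corresponding finitely many fields
  \<open>P\<^sub>k(a\<^sub>k) P\<^sub>k\<close> generate \<open>V\<close> (\<open>global_square_span\<close>). Over the complex numbers the Nullstellensatz
  follows from a count of dimensions: if all \<open>x\<^sub>i - c\<close>, for \<open>c\<close> in \<open>\<complex>\<close>, were invertible modulo a proper
  ideal, then their inverses would be uncountably many independent elements of a space of countable
  dimension (\<open>exists_root_of_coordinate\<close>).
\<close>

section \<open>Polynomial functions by degree\<close>

text \<open>
  The pointwise operations make the functions into a complex vector space, so that spans and
  linear independence of polynomial functions are those of the generic theory.
\<close>

interpretation funs: vector_space "\<lambda>(c::complex) (f :: 'a \<Rightarrow> complex) x. c * f x"
  by unfold_locales (auto simp: fun_eq_iff algebra_simps)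

text \<open>
  Monomials are indexed by lists of coordinates: splitting a monomial of high degree into two
  factors of prescribed degree is then splitting a list.
\<close>

definition monomial :: "'n list \<Rightarrow> complex ^ 'n \<Rightarrow> complex" where
  "monomial is x = (\<Prod>i\<leftarrow>is. x $ i)"

definition polyfuns_le :: "nat \<Rightarrow> (complex ^ 'n \<Rightarrow> complex) set" where
  "polyfuns_le k = funs.span (monomial ` {is. length is \<le> k})"

lemma finite_monomials: "finite (monomial ` {is :: 'n::finite list. length is \<le> k})"
  using finite_lists_length_le[of "UNIV :: 'n set" k] by simp

lemma monomial_append: "monomial (is @ js) = (\<lambda>x. monomial is x * monomial js x)"
  by (simp add: monomial_def fun_eq_iff)

lemma monomial_in_polyfuns: "monomial is \<in> polyfuns"
proof (induction "is")
  case Nil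
  show ?case using polyfuns.const[of 1] by (simp add: monomial_def[abs_def])
next
  case (Cons i "is")
  show ?case using polyfuns.mult[OF polyfuns.coord[of i] Cons] by (simp add: monomial_def[abs_def])
qed

lemma polyfuns_le_mono: "k \<le> l \<Longrightarrow> polyfuns_le k \<subseteq> polyfuns_le l"
  unfolding polyfuns_le_def by (intro funs.span_mono) auto

lemma monomial_in_polyfuns_le: "length is \<le> k \<Longrightarrow> monomial is \<in> polyfuns_le k"
  unfolding polyfuns_le_def by (intro funs.span_base) auto

lemma polyfuns_le_add:
  "f \<in> polyfuns_le k \<Longrightarrow> g \<in> polyfuns_le k \<Longrightarrow> (\<lambda>x. f x + g x) \<in> polyfuns_le k"
  unfolding polyfuns_le_def using funs.span_add by (force simp: plus_fun_def)

lemma polyfuns_le_mult: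
  assumes f: "f \<in> polyfuns_le k" and g: "g \<in> polyfuns_le l"
  shows "(\<lambda>x. f x * g x) \<in> polyfuns_le (k + l)"
proof -
  have subspace: "funs.subspace {f. (\<lambda>x. h x * f x) \<in> polyfuns_le m}"
    "funs.subspace {f. (\<lambda>x. f x * h x) \<in> polyfuns_le m}" for h m
    unfolding polyfuns_le_def funs.subspace_def
    using funs.span_zero funs.span_add funs.span_scale
    by (fastforce simp: plus_fun_def zero_fun_def algebra_simps)+
  have mono: "(\<lambda>x. monomial is x * g x) \<in> polyfuns_le (k + l)" if "length is \<le> k" for "is"
    using g unfolding polyfuns_le_def[of l]
  proof (rule funs.span_induct[OF _ subspace(1)], clarify)
    fix js :: "'a list" assume "length js \<le> l"
    then show "(\<lambda>x. monomial is x * monomial js x) \<in> polyfuns_le (k + l)"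
      using that by (subst monomial_append[symmetric], intro monomial_in_polyfuns_le) simp
  qed
  show ?thesis
    using f unfolding polyfuns_le_def[of k]
    by (rule funs.span_induct[OF _ subspace(2)]) (use mono in auto)
qed

lemma polyfuns_has_degree:
  assumes "f \<in> polyfuns" shows "\<exists>k. f \<in> polyfuns_le k"
  using assms
proof induction
  case (const c)
  have "(\<lambda>x. c * monomial [] x) \<in> polyfuns_le 0"
    unfolding polyfuns_le_def by (intro funs.span_scale funs.span_base) auto
  then show ?case by (auto simp: monomial_def)
next
  case (coord i)
  show ?case using monomial_in_polyfuns_le[of "[i]" 1] by (auto simp: monomial_def[abs_def])
next
  case (add f g)
  then obtain k l where "f \<in> polyfuns_le k" "g \<in> polyfuns_le l" by blast
  then have "f \<in> polyfuns_le (max k l)" "g \<in> polyfuns_le (max k l)"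
    using polyfuns_le_mono[of k "max k l"] polyfuns_le_mono[of l "max k l"] by auto
  then show ?case using polyfuns_le_add by blast
next
  case (mult f g)
  then show ?case using polyfuns_le_mult by blast
qed

lemma polyfuns_diff: "f \<in> polyfuns \<Longrightarrow> g \<in> polyfuns \<Longrightarrow> (\<lambda>x. f x - g x) \<in> polyfuns"
  using polyfuns.add[OF _ polyfuns.mult[OF polyfuns.const[of "-1"]], of f g] by simp

lemma polyfuns_sum: "finite A \<Longrightarrow> (\<And>a. a \<in> A \<Longrightarrow> f a \<in> polyfuns) \<Longrightarrow> (\<lambda>x. \<Sum>a\<in>A. f a x) \<in> polyfuns"
  by (induction A rule: finite_induct) (auto intro: polyfuns.intros)

lemma polyfuns_prod: "finite A \<Longrightarrow> (\<And>a. a \<in> A \<Longrightarrow> f a \<in> polyfuns) \<Longrightarrow> (\<lambda>x. \<Prod>a\<in>A. f a x) \<in> polyfuns"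
  by (induction A rule: finite_induct) (auto intro: polyfuns.intros)

lemma polyfuns_poly: "(\<lambda>x. poly p (x $ i)) \<in> polyfuns"
proof (induction p)
  case 0
  show ?case using polyfuns.const[of 0] by simp
next
  case (pCons a p)
  show ?case
    using polyfuns.add[OF polyfuns.const[of a] polyfuns.mult[OF polyfuns.coord[of i] pCons.IH]] by simp
qed

section \<open>The weak Nullstellensatz\<close>

definition polyfun_ideal :: "(complex ^ 'n \<Rightarrow> complex) set \<Rightarrow> bool" where
  "polyfun_ideal J \<longleftrightarrow> J \<subseteq> polyfuns \<and> (\<lambda>x. 0) \<in> J \<and>
     (\<forall>f\<in>J. \<forall>g\<in>J. (\<lambda>x. f x + g x) \<in> J) \<and> (\<forall>f\<in>polyfuns. \<forall>g\<in>J. (\<lambda>x. f x * g x) \<in> J)"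

lemma polyfun_idealD:
  assumes "polyfun_ideal J"
  shows "f \<in> J \<Longrightarrow> f \<in> polyfuns" "(\<lambda>x. 0) \<in> J"
    "f \<in> J \<Longrightarrow> g \<in> J \<Longrightarrow> (\<lambda>x. f x + g x) \<in> J"
    "f \<in> polyfuns \<Longrightarrow> g \<in> J \<Longrightarrow> (\<lambda>x. f x * g x) \<in> J"
  using assms unfolding polyfun_ideal_def by blast+

lemma polyfun_ideal_diff:
  assumes "polyfun_ideal J" "f \<in> J" "g \<in> J"
  shows "(\<lambda>x. f x - g x) \<in> J"
  using polyfun_idealD(3)[OF assms(1,2) polyfun_idealD(4)[OF assms(1) polyfuns.const[of "-1"] assms(3)]]
  by simp

lemma polyfun_ideal_sum:
  assumes "polyfun_ideal J" "finite A" "\<And>a. a \<in> A \<Longrightarrow> f a \<in> J"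
  shows "(\<lambda>x. \<Sum>a\<in>A. f a x) \<in> J"
  using assms(2,3) by (induction A rule: finite_induct) (auto intro: polyfun_idealD[OF assms(1)])

lemma polyfun_ideal_const:
  assumes "polyfun_ideal J" "(\<lambda>x. c) \<in> J" "c \<noteq> 0"
  shows "(\<lambda>x. 1) \<in> J"
  using polyfun_idealD(4)[OF assms(1) polyfuns.const[of "inverse c"] assms(2)] assms(3) by simp

definition adjoin ::
  "(complex ^ 'n \<Rightarrow> complex) set \<Rightarrow> (complex ^ 'n \<Rightarrow> complex) \<Rightarrow> (complex ^ 'n \<Rightarrow> complex) set"
where
  "adjoin J h = {\<lambda>x. f x + g x * h x | f g. f \<in> J \<and> g \<in> polyfuns}"

lemma adjoinI:
  assumes "f \<in> J" "g \<in> polyfuns" "\<And>x. a x = f x + g x * h x"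
  shows "a \<in> adjoin J h"
proof -
  have "a = (\<lambda>x. f x + g x * h x)" using assms(3) by blast
  then show ?thesis unfolding adjoin_def using assms(1,2) by blast
qed

lemma adjoinE:
  assumes "a \<in> adjoin J h"
  obtains f g where "f \<in> J" "g \<in> polyfuns" "a = (\<lambda>x. f x + g x * h x)"
  using assms unfolding adjoin_def by blast

lemma polyfun_ideal_adjoin:
  fixes J :: "(complex ^ 'n \<Rightarrow> complex) set"
  assumes J: "polyfun_ideal J" and h: "h \<in> polyfuns"
  shows "polyfun_ideal (adjoin J h)"
  unfolding polyfun_ideal_def
proof (intro conjI ballI)
  show "adjoin J h \<subseteq> polyfuns"
    using h by (auto simp: adjoin_def intro!: polyfuns.add polyfuns.mult dest: polyfun_idealD(1)[OF J])
  show "(\<lambda>x. 0) \<in> adjoin J h"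
    by (rule adjoinI[OF polyfun_idealD(2)[OF J] polyfuns.const[of 0]]) simp
next
  fix a b assume "a \<in> adjoin J h" "b \<in> adjoin J h"
  then obtain f g f' g' where fg: "f \<in> J" "g \<in> polyfuns" "a = (\<lambda>x. f x + g x * h x)"
    "f' \<in> J" "g' \<in> polyfuns" "b = (\<lambda>x. f' x + g' x * h x)" by (elim adjoinE)
  show "(\<lambda>x. a x + b x) \<in> adjoin J h"
    by (rule adjoinI[OF polyfun_idealD(3)[OF J fg(1,4)] polyfuns.add[OF fg(2,5)]])
      (simp add: fg algebra_simps)
next
  fix a b :: "complex ^ 'n \<Rightarrow> complex" assume a: "a \<in> polyfuns" and "b \<in> adjoin J h"
  then obtain f g where fg: "f \<in> J" "g \<in> polyfuns" "b = (\<lambda>x. f x + g x * h x)"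
    by (elim adjoinE)
  show "(\<lambda>x. a x * b x) \<in> adjoin J h"
    by (rule adjoinI[OF polyfun_idealD(4)[OF J a fg(1)] polyfuns.mult[OF a fg(2)]])
      (simp add: fg algebra_simps)
qed

lemma adjoin_superset: "J \<subseteq> adjoin J h"
  by (auto intro: adjoinI[OF _ polyfuns.const[of 0]])

lemma adjoin_generator: "polyfun_ideal J \<Longrightarrow> h \<in> adjoin J h"
  by (rule adjoinI[OF polyfun_idealD(2) polyfuns.const[of 1]]) auto

text \<open>
  The polynomial functions are a countable union of finite-dimensional spaces. One of these
  contains uncountably many, hence more than its dimension many, members of the family.
\<close>

lemma uncountable_family_dependent:
  fixes g :: "'b \<Rightarrow> complex ^ 'n \<Rightarrow> complex"
  assumes g: "\<And>c. g c \<in> polyfuns" and inj: "inj g" and unc: "uncountable (UNIV :: 'b set)"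
  shows "\<exists>F (u :: 'b \<Rightarrow> complex). finite F \<and> (\<exists>c\<in>F. u c \<noteq> 0) \<and> (\<forall>x. (\<Sum>c\<in>F. u c * g c x) = 0)"
proof -
  have "UNIV = (\<Union>k. {c. g c \<in> polyfuns_le k})"
    using polyfuns_has_degree[OF g] by blast
  then obtain k where k: "uncountable {c. g c \<in> polyfuns_le k}"
    using unc by (metis countable_UN countableI_type)
  let ?T = "monomial ` {is :: 'n list. length is \<le> k}"
  have "infinite {c. g c \<in> polyfuns_le k}" using k countable_finite by blast
  then obtain F where F: "F \<subseteq> {c. g c \<in> polyfuns_le k}" "finite F" "card F = Suc (card ?T)"
    using infinite_arbitrarily_large by blast
  have inj: "inj_on g F" using inj by (rule inj_on_subset) simp
  have "funs.dependent (g ` F)"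
  proof (rule ccontr)
    assume "\<not> ?thesis"
    then have "card (g ` F) \<le> card ?T"
      using F(1) funs.independent_span_bound[OF finite_monomials, of "g ` F" k]
      unfolding polyfuns_le_def by blast
    then show False using F(3) by (simp add: card_image[OF inj])
  qed
  then obtain u c where u: "c \<in> F" "u (g c) \<noteq> 0" "(\<Sum>v\<in>g ` F. (\<lambda>x. u v * v x)) = 0"
    using funs.dependent_finite[of "g ` F"] F(2) by auto
  have "(\<Sum>c\<in>F. u (g c) * g c x) = 0" for x
  proof -
    have *: "(\<Sum>v\<in>A. h v) x = (\<Sum>v\<in>A. h v x)" for A and h :: "('a \<Rightarrow> complex) \<Rightarrow> 'a \<Rightarrow> complex" and x
      by (induction A rule: infinite_finite_induct) auto
    have "(\<Sum>v\<in>g ` F. u v * v x) = 0"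
      using fun_cong[OF u(3), of x] unfolding * by simp
    then show ?thesis by (simp add: sum.reindex[OF inj])
  qed
  then show ?thesis using F(2) u(1,2) by (intro exI[of _ F] exI[of _ "\<lambda>c. u (g c)"]) auto
qed

text \<open>
  If \<open>x\<^sub>i - c\<close> were invertible modulo \<open>J\<close> for every \<open>c\<close>, then the linear factors of a polynomial
  relation for \<open>x\<^sub>i\<close> modulo \<open>J\<close> could be cancelled one after the other, until a nonzero constant in \<open>J\<close> is left.
\<close>

lemma coordinate_relation_has_root:
  fixes p :: "complex poly"
  assumes J: "polyfun_ideal J" and p: "p \<noteq> 0" "(\<lambda>x. poly p (x $ i)) \<in> J" and one: "(\<lambda>x. 1) \<notin> J"
  shows "\<exists>c. (\<lambda>x. 1) \<notin> adjoin J (\<lambda>x. x $ i - c)"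
proof (rule ccontr)
  assume all: "\<not> ?thesis"
  have "(\<lambda>x. poly p (x $ i)) \<in> J \<Longrightarrow> (\<lambda>x. 1) \<in> J" if "p \<noteq> 0" for p :: "complex poly"
    using that
  proof (induction "degree p" arbitrary: p)
    case 0
    then obtain c where "p = [:c:]" by (metis degree_eq_zeroE)
    then show ?case using polyfun_ideal_const[OF J, of c] 0 by simp
  next
    case (Suc n)
    then obtain r where "poly p r = 0"
      using fundamental_theorem_of_algebra[of p] constant_degree[of p] by auto
    then obtain q where q: "p = [:-r, 1:] * q"
      by (metis poly_eq_0_iff_dvd dvdE)
    with Suc have q0: "q \<noteq> 0" by auto
    have "degree p = degree [:-r, 1:] + degree q" unfolding q by (rule degree_mult_eq) (use q0 in auto)
    then have deg: "n = degree q" using Suc(2) by simp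
    obtain f g where fg: "f \<in> J" "g \<in> polyfuns" "(\<lambda>x. 1) = (\<lambda>x. f x + g x * (x $ i - r))"
      using all unfolding adjoin_def by blast
    have "(\<lambda>x. poly q (x $ i)) = (\<lambda>x. poly q (x $ i) * f x + g x * poly p (x $ i))"
    proof
      fix x
      have "poly q (x $ i) * 1 = poly q (x $ i) * (f x + g x * (x $ i - r))"
        using fun_cong[OF fg(3), of x] by simp
      then show "poly q (x $ i) = poly q (x $ i) * f x + g x * poly p (x $ i)"
        by (simp add: q algebra_simps)
    qed
    also have "\<dots> \<in> J"
      by (intro polyfun_idealD(3)[OF J] polyfun_idealD(4)[OF J] polyfuns_poly fg Suc.prems(1))
    finally show ?case using Suc.hyps(1)[OF deg] q0 by blast
  qed
  then show False using p one by blast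
qed

text \<open>
  Some polynomial relation for \<open>x\<^sub>i\<close> modulo \<open>J\<close> must exist: otherwise there are inverses \<open>g\<^sub>c\<close> of
  \<open>x\<^sub>i - c\<close> modulo \<open>J\<close> for all \<open>c\<close>, and a linear dependence among these uncountably many functions
  turns into such a relation when denominators are cleared.
\<close>

lemma exists_root_of_coordinate:
  assumes J: "polyfun_ideal J" and one: "(\<lambda>x. 1) \<notin> J"
  shows "\<exists>c. (\<lambda>x. 1) \<notin> adjoin J (\<lambda>x. x $ i - c)"
proof (rule ccontr)
  assume all: "\<not> ?thesis"
  then have "\<forall>c. \<exists>f g. f \<in> J \<and> g \<in> polyfuns \<and> (\<forall>x. f x + g x * (x $ i - c) = 1)"
    unfolding adjoin_def by simp metis
  then obtain f g where fg: "\<And>c. f c \<in> J" "\<And>c. g c \<in> polyfuns"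
    "\<And>c x. f c x + g c x * (x $ i - c) = 1" by metis
  have inj: "inj g"
  proof (rule injI, rule ccontr)
    fix c d assume cd: "g c = g d" "c \<noteq> d"
    have "(\<lambda>x. f c x - f d x) = (\<lambda>x. (c - d) * g c x)"
    proof
      fix x
      have "f c x + g c x * (x $ i - c) = f d x + g c x * (x $ i - d)"
        using fg(3)[of c x] fg(3)[of d x] cd(1) by simp
      then show "f c x - f d x = (c - d) * g c x" by (simp add: algebra_simps)
    qed
    then have "(\<lambda>x. (c - d) * g c x) \<in> J"
      using polyfun_ideal_diff[OF J fg(1)[of c] fg(1)[of d]] by simp
    from polyfun_idealD(4)[OF J polyfuns.const[of "inverse (c - d)"] this] cd(2)
    have "g c \<in> J" by (simp add: mult.assoc[symmetric])
    then have "(\<lambda>x. f c x + (x $ i - c) * g c x) \<in> J"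
      by (intro polyfun_idealD(3)[OF J fg(1)] polyfun_idealD(4)[OF J]
          polyfuns_diff polyfuns.coord polyfuns.const)
    then show False using one fg(3)[of c] by (simp add: mult.commute)
  qed
  obtain F u where F: "finite F" and u: "\<exists>c\<in>F. u c \<noteq> 0" "\<And>x. (\<Sum>c\<in>F. u c * g c x) = 0"
    using uncountable_family_dependent[OF fg(2) inj uncountable_UNIV_complex] by blast
  \<comment> \<open>The relation \<open>\<Sum> u\<^sub>c g\<^sub>c = 0\<close> multiplied by \<open>\<Prod> (x\<^sub>i - d)\<close>, with \<open>g\<^sub>c (x\<^sub>i - c)\<close> replaced by 1.\<close>
  define p where "p = (\<Sum>c\<in>F. smult (u c) (\<Prod>d\<in>F - {c}. [:-d, 1:]))"
  have poly_p: "poly p z = (\<Sum>c\<in>F. u c * (\<Prod>d\<in>F - {c}. z - d))" for z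
    by (simp add: p_def poly_sum poly_prod)
  have "p \<noteq> 0"
  proof
    assume "p = 0"
    obtain c where c: "c \<in> F" "u c \<noteq> 0" using u(1) by blast
    \<comment> \<open>At \<open>c\<close> every summand but the one of \<open>c\<close> vanishes.\<close>
    have "poly p c = (\<Sum>e\<in>{c}. u e * (\<Prod>d\<in>F - {e}. c - d))"
      unfolding poly_p using c F by (intro sum.mono_neutral_right) auto
    then have "u c * (\<Prod>d\<in>F - {c}. c - d) = 0" using \<open>p = 0\<close> by simp
    then show False using c F by auto
  qed
  moreover have "(\<lambda>x. poly p (x $ i)) \<in> J"
  proof -
    have "poly p (x $ i) = (\<Sum>c\<in>F. (u c * (\<Prod>d\<in>F - {c}. x $ i - d)) * f c x)" for x
    proof -
      have "poly p (x $ i) - (\<Sum>c\<in>F. (u c * (\<Prod>d\<in>F - {c}. x $ i - d)) * f c x)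
        = (\<Sum>c\<in>F. (u c * (\<Prod>d\<in>F - {c}. x $ i - d)) * (1 - f c x))"
        unfolding poly_p by (simp add: sum_subtractf algebra_simps)
      also have "\<dots> = (\<Sum>c\<in>F. u c * g c x * (\<Prod>d\<in>F. x $ i - d))"
      proof (rule sum.cong[OF refl])
        fix c assume "c \<in> F"
        have "1 - f c x = (x $ i - c) * g c x"
          using fg(3)[of c x] by (simp add: algebra_simps)
        then show "(u c * (\<Prod>d\<in>F - {c}. x $ i - d)) * (1 - f c x) = u c * g c x * (\<Prod>d\<in>F. x $ i - d)"
          using prod.remove[OF F \<open>c \<in> F\<close>, of "\<lambda>d. x $ i - d"] by simp
      qed
      also have "\<dots> = 0" using u(2)[of x] by (simp add: sum_distrib_right[symmetric])
      finally show ?thesis by simp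
    qed
    then show ?thesis
      by (auto intro!: polyfun_ideal_sum[OF J F] polyfun_idealD(4)[OF J] polyfuns.mult
          polyfuns_prod polyfuns_diff polyfuns.const polyfuns.coord F fg(1))
  qed
  ultimately show False using coordinate_relation_has_root[OF J _ _ one] all by blast
qed

text \<open>
  A proper ideal stays proper after adjoining \<open>x\<^sub>i - p\<^sub>i\<close> for suitable constants \<open>p\<^sub>i\<close>, one coordinate after
  the other. Modulo the resulting ideal every polynomial function equals its value at \<open>p\<close>, so \<open>p\<close> is a common zero
  of the ideal.
\<close>

theorem weak_Nullstellensatz:
  fixes J :: "(complex ^ 'n \<Rightarrow> complex) set"
  assumes J: "polyfun_ideal J" and no_zero: "\<And>p. \<exists>f\<in>J. f p \<noteq> 0"
  shows "(\<lambda>x. 1) \<in> J"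
proof (rule ccontr)
  assume one: "(\<lambda>x. 1) \<notin> J"
  have "\<exists>K p. polyfun_ideal K \<and> J \<subseteq> K \<and> (\<lambda>x. 1) \<notin> K \<and> (\<forall>i\<in>S. (\<lambda>x. x $ i - p $ i) \<in> K)"
    for S :: "'n set"
    using finite[of S]
  proof (induction S rule: finite_induct)
    case empty
    show ?case using J one by blast
  next
    case (insert i S)
    then obtain K and p :: "complex ^ 'n" where K: "polyfun_ideal K" "J \<subseteq> K" "(\<lambda>x. 1) \<notin> K" "\<forall>i\<in>S. (\<lambda>x. x $ i - p $ i) \<in> K"
      by blast
    obtain c where c: "(\<lambda>x. 1) \<notin> adjoin K (\<lambda>x. x $ i - c)"
      using exists_root_of_coordinate[OF K(1,3)] by blast
    define q where "q = (\<chi> j. if j = i then c else p $ j)"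
    have "polyfun_ideal (adjoin K (\<lambda>x. x $ i - c))"
      by (intro polyfun_ideal_adjoin K polyfuns_diff polyfuns.coord polyfuns.const)
    moreover have "\<forall>j\<in>insert i S. (\<lambda>x. x $ j - q $ j) \<in> adjoin K (\<lambda>x. x $ i - c)"
      using adjoin_generator[OF K(1)] adjoin_superset[of K] K(4) insert(2) by (auto simp: q_def)
    ultimately show ?case using c K(2) adjoin_superset[of K] by blast
  qed
  from this[of UNIV] obtain K and p :: "complex ^ 'n" where K: "polyfun_ideal K" "J \<subseteq> K" "(\<lambda>x. 1) \<notin> K"
    "\<And>i. (\<lambda>x. x $ i - p $ i) \<in> K" by blast
  have eval: "(\<lambda>x. f x - f p) \<in> K" if "f \<in> polyfuns" for f
    using that
  proof induction
    case (const c)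
    then show ?case using polyfun_idealD(2)[OF K(1)] by simp
  next
    case (coord i)
    then show ?case by (rule K)
  next
    case (add f g)
    show ?case using polyfun_idealD(3)[OF K(1) add.IH] by (simp add: algebra_simps)
  next
    case (mult f g)
    have "(\<lambda>x. f x * (g x - g p) + (\<lambda>x. g p) x * (f x - f p)) \<in> K"
      by (intro polyfun_idealD(3)[OF K(1)] polyfun_idealD(4)[OF K(1)] mult polyfuns.const)
    then show ?case by (simp add: algebra_simps)
  qed
  obtain f where f: "f \<in> J" "f p \<noteq> 0" using no_zero by blast
  have "f \<in> K" using f K(2) by blast
  then have "(\<lambda>x. f x - (f x - f p)) \<in> K"
    by (intro polyfun_ideal_diff[OF K(1)] eval polyfun_idealD(1)[OF K(1)])
  then show False using polyfun_ideal_const[OF K(1)] f(2) K(3) by simp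
qed

section \<open>Lie algebras spanned by multiples of the fields \<open>P(a) P\<close>\<close>

definition restr :: "(complex ^ 'n) set \<Rightarrow> (complex ^ 'n \<Rightarrow> complex) \<Rightarrow> complex ^ 'n \<Rightarrow> complex" where
  "restr U f = (\<lambda>x. if x \<in> U then f x else 0)"

lemma restr_in_coord_ring: "f \<in> polyfuns \<Longrightarrow> restr U f \<in> coord_ring U"
  by (auto simp: restr_def coord_ring_def)

lemma coord_ringE:
  assumes "g \<in> coord_ring U" obtains f where "f \<in> polyfuns" "g = restr U f"
  using assms by (auto simp: restr_def coord_ring_def)

lemma coord_ring_outside: "f \<in> coord_ring U \<Longrightarrow> x \<notin> U \<Longrightarrow> f x = 0"
  by (auto simp: coord_ring_def)

lemma vector_field_outside:
  assumes "X \<in> vector_fields U" "x \<notin> U" shows "X f x = 0"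
  using vector_fields_D(1,2)[OF assms(1), of f] coord_ring_outside[OF _ assms(2)]
  by (cases "f \<in> coord_ring U") auto

lemma vector_field_const:
  assumes X: "X \<in> vector_fields U"
  shows "X (restr U (\<lambda>x. c)) = (\<lambda>x. 0)"
proof -
  have 1: "restr U (\<lambda>x. 1) \<in> coord_ring U" by (intro restr_in_coord_ring polyfuns.const)
  have "X (restr U (\<lambda>x. 1)) = X (\<lambda>x. restr U (\<lambda>x. 1) x * restr U (\<lambda>x. 1) x)"
    by (rule arg_cong[of _ _ X]) (auto simp: restr_def)
  also have "\<dots> = (\<lambda>x. 2 * X (restr U (\<lambda>x. 1)) x)"
    unfolding vector_fields_D(5)[OF X 1 1]
    by (auto simp: fun_eq_iff restr_def vector_field_outside[OF X])
  finally have "X (restr U (\<lambda>x. 1)) x = 2 * X (restr U (\<lambda>x. 1)) x" for x by metis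
  then have one: "X (restr U (\<lambda>x. 1)) = (\<lambda>x. 0)" by (simp add: fun_eq_iff)
  have "X (restr U (\<lambda>x. c)) = X (\<lambda>x. c * restr U (\<lambda>x. 1) x)"
    by (rule arg_cong[of _ _ X]) (auto simp: restr_def)
  then show ?thesis unfolding vector_fields_D(4)[OF X 1] one by simp
qed

lemma vector_field_restr_add:
  assumes "X \<in> vector_fields U" "f \<in> polyfuns" "g \<in> polyfuns"
  shows "X (restr U (\<lambda>x. f x + g x)) = (\<lambda>x. X (restr U f) x + X (restr U g) x)"
proof -
  have "restr U (\<lambda>x. f x + g x) = (\<lambda>x. restr U f x + restr U g x)" by (auto simp: restr_def)
  then show ?thesis
    using vector_fields_D(3)[OF assms(1)] assms(2,3) by (simp add: restr_in_coord_ring)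
qed

lemma polyfun_times_restr: "g \<in> coord_ring U \<Longrightarrow> (\<lambda>x. f x * g x) = (\<lambda>x. restr U f x * g x)"
  by (auto simp: restr_def fun_eq_iff coord_ring_outside)

lemma vector_field_times:
  assumes X: "X \<in> vector_fields U" and f: "f \<in> polyfuns" and g: "g \<in> coord_ring U"
  shows "X (\<lambda>x. f x * g x) = (\<lambda>x. f x * X g x + g x * X (restr U f) x)"
  unfolding polyfun_times_restr[OF g, of f] vector_fields_D(5)[OF X restr_in_coord_ring[OF f] g]
  by (auto simp: restr_def fun_eq_iff vector_field_outside[OF X])

lemma vector_field_restr_mult:
  assumes X: "X \<in> vector_fields U" and f: "f \<in> polyfuns" and g: "g \<in> polyfuns"
  shows "X (restr U (\<lambda>x. f x * g x)) = (\<lambda>x. f x * X (restr U g) x + g x * X (restr U f) x)"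
proof -
  have "restr U (\<lambda>x. f x * g x) = (\<lambda>x. f x * restr U g x)"
    by (auto simp: restr_def)
  then show ?thesis
    unfolding vector_field_times[OF X f restr_in_coord_ring[OF g], symmetric]
    using vector_field_times[OF X f restr_in_coord_ring[OF g]]
    by (auto simp: fun_eq_iff restr_def vector_field_outside[OF X])
qed

lemma coord_ring_times: "f \<in> polyfuns \<Longrightarrow> g \<in> coord_ring U \<Longrightarrow> (\<lambda>x. f x * g x) \<in> coord_ring U"
  using coord_ring_mult[OF restr_in_coord_ring] polyfun_times_restr[of g U f] by metis

lemma vector_fields_scale:
  assumes X: "X \<in> vector_fields U" and p: "p \<in> polyfuns"
  shows "(\<lambda>f x. p x * X f x) \<in> vector_fields U"
  unfolding vector_fields_def
  by (auto simp: vector_fields_D[OF X] coord_ring_times p algebra_simps)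

lemma bracket_multiples_of_field:
  assumes P: "P \<in> vector_fields U" and p: "p \<in> polyfuns" and q: "q \<in> polyfuns"
  shows "lie_bracket (\<lambda>f x. p x * P f x) (\<lambda>f x. q x * P f x)
    = (\<lambda>f x. (p x * P (restr U q) x - q x * P (restr U p) x) * P f x)"
proof (intro ext)
  fix f x
  show "lie_bracket (\<lambda>f x. p x * P f x) (\<lambda>f x. q x * P f x) f x
    = (p x * P (restr U q) x - q x * P (restr U p) x) * P f x"
  proof (cases "f \<in> coord_ring U")
    case True
    then have "P f \<in> coord_ring U" by (rule vector_fields_D[OF P])
    then show ?thesis
      by (simp add: lie_bracket_def vector_field_times[OF P] p q algebra_simps)
  next
    case False
    then show ?thesis
      by (simp add: lie_bracket_def vector_fields_D(1)[OF P] vector_fields_zero[OF P])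
  qed
qed

text \<open>
  The identity \<open>[u a P, v P] - [u P, v a P] = - 2 u v P(a) P\<close>. In the difference the terms with
  derivatives of \<open>u\<close> and \<open>v\<close> cancel, so that a multiple of \<open>P(a) P\<close> by a product is made from brackets
  whose entries only involve one factor each.
\<close>

lemma product_multiple_as_bracket:
  assumes P: "P \<in> vector_fields U" and u: "u \<in> polyfuns" and v: "v \<in> polyfuns" and a: "a \<in> polyfuns"
  shows "(\<lambda>f x. u x * v x * (P (restr U a) x * P f x)) = (\<lambda>f x. - 1 / 2 *
    (lie_bracket (\<lambda>f x. (u x * a x) * P f x) (\<lambda>f x. v x * P f x) f x +
     (- 1) * lie_bracket (\<lambda>f x. u x * P f x) (\<lambda>f x. (v x * a x) * P f x) f x))"
  unfolding bracket_multiples_of_field[OF P polyfuns.mult[OF u a] v]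
    bracket_multiples_of_field[OF P u polyfuns.mult[OF v a]]
    vector_field_restr_mult[OF P u a] vector_field_restr_mult[OF P v a]
  by (intro ext) (simp add: algebra_simps)

text \<open>
  The \<open>\<O>(U)\<close>-module generated by the fields \<open>P(a) P\<close>, the contractions of \<open>P \<otimes> P\<close> with \<open>da\<close>, for
  \<open>(P, a)\<close> in \<open>T\<close>. Polynomial functions serve as coefficients because they represent all of \<open>\<O>(U)\<close>.
\<close>

inductive_set square_span ::
  "(complex ^ 'n) set
   \<Rightarrow> (((complex ^ 'n \<Rightarrow> complex) \<Rightarrow> complex ^ 'n \<Rightarrow> complex) \<times> (complex ^ 'n \<Rightarrow> complex)) set
   \<Rightarrow> ((complex ^ 'n \<Rightarrow> complex) \<Rightarrow> complex ^ 'n \<Rightarrow> complex) set"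
  for U T where
  zero: "(\<lambda>f x. 0) \<in> square_span U T"
| add: "X \<in> square_span U T \<Longrightarrow> Y \<in> square_span U T \<Longrightarrow> (\<lambda>f x. X f x + Y f x) \<in> square_span U T"
| square: "(P, a) \<in> T \<Longrightarrow> h \<in> polyfuns \<Longrightarrow> (\<lambda>f x. h x * (P (restr U a) x * P f x)) \<in> square_span U T"

lemma lie_closedD:
  assumes "lie_closed L"
  shows "(\<lambda>f x. 0) \<in> L" "D \<in> L \<Longrightarrow> E \<in> L \<Longrightarrow> (\<lambda>f x. D f x + E f x) \<in> L"
    "D \<in> L \<Longrightarrow> (\<lambda>f x. c * D f x) \<in> L" "D \<in> L \<Longrightarrow> E \<in> L \<Longrightarrow> lie_bracket D E \<in> L"
  using assms unfolding lie_closed_def by blast+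

lemma lie_closed_hull: "lie_closed (lie_closed hull S)"
  by (rule hull_in) (simp add: lie_closed_def)

lemma lie_closed_polyfuns_le:
  fixes u :: "complex ^ 'n \<Rightarrow> complex"
  assumes L: "lie_closed L" and mono: "\<And>is. length is \<le> k \<Longrightarrow> (\<lambda>f x. monomial is x * X f x) \<in> L"
    and u: "u \<in> polyfuns_le k"
  shows "(\<lambda>f x. u x * X f x) \<in> L"
proof -
  have "funs.subspace {u. (\<lambda>f x. u x * X f x) \<in> L}"
    unfolding funs.subspace_def
  proof (intro conjI allI ballI; unfold mem_Collect_eq)
    show "(\<lambda>f x. (0 :: complex ^ 'n \<Rightarrow> complex) x * X f x) \<in> L"
      using lie_closedD(1)[OF L] by simp
  next
    fix u v assume "(\<lambda>f x. u x * X f x) \<in> L" "(\<lambda>f x. v x * X f x) \<in> L"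
    from lie_closedD(2)[OF L this] show "(\<lambda>f x. (u + v) x * X f x) \<in> L"
      by (simp add: distrib_right)
  next
    fix c u assume "(\<lambda>f x. u x * X f x) \<in> L"
    from lie_closedD(3)[OF L this, of c] show "(\<lambda>f x. c * u x * X f x) \<in> L"
      by (simp add: mult.assoc)
  qed
  from funs.span_induct[OF u[unfolded polyfuns_le_def] this] mono show ?thesis by auto
qed

lemma polyfuns_le_subset: "polyfuns_le k \<subseteq> polyfuns"
proof -
  have "funs.subspace polyfuns"
    unfolding funs.subspace_def by (auto simp: zero_fun_def plus_fun_def intro: polyfuns.intros)
  then show ?thesis
    unfolding polyfuns_le_def by (rule funs.span_minimal[rotated]) (auto intro: monomial_in_polyfuns)
qed

definition multiples_le ::
  "((complex ^ 'n \<Rightarrow> complex) \<Rightarrow> complex ^ 'n \<Rightarrow> complex) set \<Rightarrow> nat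
    \<Rightarrow> ((complex ^ 'n \<Rightarrow> complex) \<Rightarrow> complex ^ 'n \<Rightarrow> complex) set" where
  "multiples_le F m = {\<lambda>f x. u x * P f x | u P. u \<in> polyfuns_le m \<and> P \<in> F}"

lemma multiples_leI: "u \<in> polyfuns_le m \<Longrightarrow> P \<in> F \<Longrightarrow> (\<lambda>f x. u x * P f x) \<in> multiples_le F m"
  unfolding multiples_le_def by blast

lemma multiples_le_mono: "m \<le> n \<Longrightarrow> multiples_le F m \<subseteq> multiples_le F n"
  unfolding multiples_le_def using polyfuns_le_mono[of m n] by blast

text \<open>
  The number \<open>c\<close> bounds the cost of splitting a multiplier of \<open>X\<close>: the field \<open>u v X\<close> lies in the Lie
  algebra generated by the fields \<open>w P\<close>, where \<open>P\<close> is in \<open>F\<close> and the degree of \<open>w\<close> exceeds the degree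
  bound for \<open>u\<close> and \<open>v\<close> by at most \<open>c\<close>.
\<close>

definition splitting_overhead ::
  "((complex ^ 'n \<Rightarrow> complex) \<Rightarrow> complex ^ 'n \<Rightarrow> complex) set
    \<Rightarrow> ((complex ^ 'n \<Rightarrow> complex) \<Rightarrow> complex ^ 'n \<Rightarrow> complex) \<Rightarrow> nat \<Rightarrow> bool" where
  "splitting_overhead F X c \<longleftrightarrow> (\<forall>L k u v. lie_closed L \<longrightarrow> multiples_le F (k + c) \<subseteq> L \<longrightarrow>
     u \<in> polyfuns_le k \<longrightarrow> v \<in> polyfuns_le k \<longrightarrow> (\<lambda>f x. u x * v x * X f x) \<in> L)"

lemma splitting_overheadI:
  assumes "\<And>L k u v. lie_closed L \<Longrightarrow> multiples_le F (k + c) \<subseteq> L \<Longrightarrow> u \<in> polyfuns_le k \<Longrightarrow>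
    v \<in> polyfuns_le k \<Longrightarrow> (\<lambda>f x. u x * v x * X f x) \<in> L"
  shows "splitting_overhead F X c"
  unfolding splitting_overhead_def by (intro allI impI assms)

lemma splitting_overheadD:
  assumes "splitting_overhead F X c" "lie_closed L" "multiples_le F (k + c) \<subseteq> L"
    "u \<in> polyfuns_le k" "v \<in> polyfuns_le k"
  shows "(\<lambda>f x. u x * v x * X f x) \<in> L"
  using assms(1)[unfolded splitting_overhead_def, rule_format, OF assms(2-)] .

lemma splitting_overhead_mono:
  fixes X :: "(complex ^ 'n \<Rightarrow> complex) \<Rightarrow> complex ^ 'n \<Rightarrow> complex"
  assumes "splitting_overhead F X c" "c \<le> d" shows "splitting_overhead F X d"
proof (rule splitting_overheadI)
  fix L k and u v :: "complex ^ 'n \<Rightarrow> complex"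
  assume L: "lie_closed L" "multiples_le F (k + d) \<subseteq> L" and uv: "u \<in> polyfuns_le k" "v \<in> polyfuns_le k"
  have "multiples_le F (k + c) \<subseteq> L"
    using L(2) multiples_le_mono[of "k + c" "k + d" F] assms(2) by simp
  then show "(\<lambda>f x. u x * v x * X f x) \<in> L"
    by (rule splitting_overheadD[OF assms(1) L(1) _ uv])
qed

text \<open>
  A common bound for the degrees of \<open>h\<close>, \<open>a\<close> and \<open>h a\<close> is an overhead of \<open>h P(a) P\<close>, because \<open>u v h P(a) P\<close>
  is a combination of \<open>[u h a P, v P]\<close> and \<open>[u h P, v a P]\<close>.
\<close>

lemma square_span_splitting_overhead:
  fixes U :: "(complex ^ 'n) set"
  assumes X: "X \<in> square_span U T"
    and T: "\<And>P a. (P, a) \<in> T \<Longrightarrow> P \<in> vector_fields U \<and> a \<in> polyfuns"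
  shows "\<exists>c. splitting_overhead (fst ` T) X c"
  using X
proof induction
  case zero
  show ?case by (intro exI[of _ 0] splitting_overheadI) (simp add: lie_closedD(1))
next
  case (add X Y)
  then obtain c d where "splitting_overhead (fst ` T) X c" "splitting_overhead (fst ` T) Y d" by blast
  then have c: "splitting_overhead (fst ` T) X (max c d)" "splitting_overhead (fst ` T) Y (max c d)"
    using splitting_overhead_mono max.cobounded1 max.cobounded2 by blast+
  show ?case
  proof (intro exI[of _ "max c d"] splitting_overheadI)
    fix L k and u v :: "complex ^ 'n \<Rightarrow> complex"
    assume *: "lie_closed L" "multiples_le (fst ` T) (k + max c d) \<subseteq> L"
      "u \<in> polyfuns_le k" "v \<in> polyfuns_le k"
    from lie_closedD(2)[OF *(1) splitting_overheadD[OF c(1) *] splitting_overheadD[OF c(2) *]]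
    show "(\<lambda>f x. u x * v x * (X f x + Y f x)) \<in> L" by (simp add: distrib_left)
  qed
next
  case (square P a h)
  have P: "P \<in> vector_fields U" "P \<in> fst ` T" and a: "a \<in> polyfuns"
    using T[OF square(1)] square(1) by force+
  have ha: "(\<lambda>x. h x * a x) \<in> polyfuns" using square(2) a by (rule polyfuns.mult)
  obtain c1 c2 c3 where deg: "h \<in> polyfuns_le c1" "a \<in> polyfuns_le c2" "(\<lambda>x. h x * a x) \<in> polyfuns_le c3"
    using polyfuns_has_degree[OF square(2)] polyfuns_has_degree[OF a] polyfuns_has_degree[OF ha] by blast
  define c where "c = c1 + c2 + c3"
  have deg: "h \<in> polyfuns_le c" "a \<in> polyfuns_le c" "(\<lambda>x. h x * a x) \<in> polyfuns_le c"
    using deg polyfuns_le_mono[of c1 c] polyfuns_le_mono[of c2 c] polyfuns_le_mono[of c3 c]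
    by (auto simp: c_def)
  show ?case
  proof (intro exI[of _ c] splitting_overheadI)
    fix L k and u v :: "complex ^ 'n \<Rightarrow> complex"
    assume L: "lie_closed L" and multiples: "multiples_le (fst ` T) (k + c) \<subseteq> L"
      and u: "u \<in> polyfuns_le k" and v: "v \<in> polyfuns_le k"
    have in_L: "(\<lambda>f x. w x * P f x) \<in> L" if "w \<in> polyfuns_le (k + c)" for w
      using multiples multiples_leI[OF that P(2)] by blast
    have uv: "u \<in> polyfuns" "v \<in> polyfuns" using u v polyfuns_le_subset by auto
    have "(\<lambda>x. u x * h x * a x) \<in> polyfuns_le (k + c)"
      using polyfuns_le_mult[OF u deg(3)] by (simp add: mult.assoc)
    moreover have "v \<in> polyfuns_le (k + c)"
      using v polyfuns_le_mono[of k "k + c"] by auto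
    ultimately have "(\<lambda>f x. (u x * h x) * v x * (P (restr U a) x * P f x)) \<in> L"
      unfolding product_multiple_as_bracket[OF P(1) polyfuns.mult[OF uv(1) square(2)] uv(2) a]
      by (intro lie_closedD[OF L] in_L polyfuns_le_mult[OF u deg(1)] polyfuns_le_mult[OF v deg(2)])
    then show "(\<lambda>f x. u x * v x * (h x * (P (restr U a) x * P f x))) \<in> L"
      by (simp add: mult_ac)
  qed
qed

text \<open>
  With \<open>C\<close> a common overhead of the fields \<open>P\<close> in \<open>T\<close>, the multiples of these fields by monomials of degree
  at most \<open>2 C + 1\<close> generate all of them: a monomial of larger degree \<open>N + 1\<close> is a product of two monomials of
  degree at most \<open>N - C\<close>, so its multiple of \<open>P\<close> lies in the Lie algebra generated by the multiples of degree at
  most \<open>N\<close>.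
\<close>

theorem finitely_generated_if_square_span:
  fixes U :: "(complex ^ 'n) set"
  assumes fin: "finite T"
    and T: "\<And>P a. (P, a) \<in> T \<Longrightarrow> P \<in> vector_fields U \<and> a \<in> polyfuns"
    and span: "vector_fields U \<subseteq> square_span U T"
  shows "finitely_generated_lie (vector_fields U)"
proof -
  have "\<exists>c. splitting_overhead (fst ` T) P c" if "P \<in> fst ` T" for P
    using that T span by (intro square_span_splitting_overhead) auto
  then obtain c where c: "\<And>P. P \<in> fst ` T \<Longrightarrow> splitting_overhead (fst ` T) P (c P)" by metis
  define C where "C = (\<Sum>P\<in>fst ` T. c P)"
  have c_le: "c P \<le> C" if "P \<in> fst ` T" for P
    unfolding C_def using fin that by (intro member_le_sum) auto
  define S where "S = (\<lambda>(is, P). (\<lambda>f x. monomial is x * P f x)) ` ({is. length is \<le> 2 * C + 1} \<times> fst ` T)"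
  define L where "L = lie_closed hull S"
  have L: "lie_closed L" unfolding L_def by (rule lie_closed_hull)
  have "finite {is :: 'n list. length is \<le> 2 * C + 1}"
    using finite_lists_length_le[of "UNIV :: 'n set"] by simp
  then have "finite S" unfolding S_def using fin by blast
  have "S \<subseteq> vector_fields U"
    unfolding S_def using T by (auto intro!: vector_fields_scale monomial_in_polyfuns)
  then have L_sub: "L \<subseteq> vector_fields U"
    unfolding L_def by (rule hull_minimal) (rule lie_closed_vector_fields)
  have multiplesI: "multiples_le (fst ` T) k \<subseteq> L"
    if "\<And>P is. P \<in> fst ` T \<Longrightarrow> length is \<le> k \<Longrightarrow> (\<lambda>f x. monomial is x * P f x) \<in> L" for k
  proof
    fix X assume "X \<in> multiples_le (fst ` T) k"
    then obtain u P where "X = (\<lambda>f x. u x * P f x)" "u \<in> polyfuns_le k" "P \<in> fst ` T"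
      unfolding multiples_le_def by blast
    then show "X \<in> L" using lie_closed_polyfuns_le[OF L that] by simp
  qed
  have level: "multiples_le (fst ` T) (2 * C + 1 + k) \<subseteq> L" for k
  proof (induction k)
    case 0
    show ?case
    proof (rule multiplesI)
      fix P "is" assume "P \<in> fst ` T" "length (is :: 'n list) \<le> 2 * C + 1 + 0"
      then have "(is, P) \<in> {is. length is \<le> 2 * C + 1} \<times> fst ` T" by simp
      then have "(\<lambda>f x. monomial is x * P f x) \<in> S"
        unfolding S_def by (rule rev_image_eqI) simp
      then show "(\<lambda>f x. monomial is x * P f x) \<in> L"
        unfolding L_def by (rule hull_inc)
    qed
  next
    case (Suc k)
    show ?case
    proof (rule multiplesI)
      fix P "is" assume P: "P \<in> fst ` T" and len: "length (is :: 'n list) \<le> 2 * C + 1 + Suc k"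
      \<comment> \<open>The list has at most \<open>2 C + 2 + k \<le> 2 n\<close> entries, and a factor of degree \<open>n\<close> with the
          overhead \<open>C\<close> is still covered by the induction hypothesis.\<close>
      define n where "n = C + 1 + k"
      have "n + C = 2 * C + 1 + k" by (simp add: n_def)
      then have "multiples_le (fst ` T) (n + C) \<subseteq> L" using Suc.IH by (simp only:)
      moreover have "monomial (take n is) \<in> polyfuns_le n" "monomial (drop n is) \<in> polyfuns_le n"
        using len by (auto intro!: monomial_in_polyfuns_le simp: n_def)
      ultimately have "(\<lambda>f x. monomial (take n is) x * monomial (drop n is) x * P f x) \<in> L"
        by (rule splitting_overheadD[OF splitting_overhead_mono[OF c[OF P] c_le[OF P]] L])
      then show "(\<lambda>f x. monomial is x * P f x) \<in> L"
        using monomial_append[of "take n is" "drop n is"] by simp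
    qed
  qed
  have all: "(\<lambda>f x. u x * P f x) \<in> L" if P: "P \<in> fst ` T" and u: "u \<in> polyfuns" for P u
  proof -
    obtain k where "u \<in> polyfuns_le k" using polyfuns_has_degree[OF u] by blast
    then have "u \<in> polyfuns_le (2 * C + 1 + k)"
      using polyfuns_le_mono[of k "2 * C + 1 + k"] by auto
    then show ?thesis using level[of k] multiples_leI[OF _ P] by blast
  qed
  have "X \<in> L" if "X \<in> square_span U T" for X
    using that
  proof induction
    case (square P a h)
    from T[OF square(1)] obtain w where w: "w \<in> polyfuns" "P (restr U a) = restr U w"
      using vector_fields_D(2)[OF _ restr_in_coord_ring] by (metis coord_ringE)
    have "(\<lambda>f x. (h x * w x) * P f x) \<in> L"
      using square w by (intro all polyfuns.mult) force+
    also have "(\<lambda>f x. (h x * w x) * P f x) = (\<lambda>f x. h x * (P (restr U a) x * P f x))"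
    proof (intro ext)
      fix f x
      show "(h x * w x) * P f x = h x * (P (restr U a) x * P f x)"
        unfolding w(2) using vector_field_outside[of P U x f] T[OF square(1)]
        by (cases "x \<in> U") (auto simp: restr_def)
    qed
    finally show ?case .
  qed (intro lie_closedD[OF L]; assumption)+
  then have "vector_fields U = lie_closed hull S"
    using L_sub span unfolding L_def by blast
  then show ?thesis
    unfolding finitely_generated_lie_def using \<open>finite S\<close> \<open>S \<subseteq> vector_fields U\<close> by metis
qed

section \<open>Gradients and derivations\<close>

lemma axis_shift_component: "(x + axis j t) $ i = x $ i + (if i = j then t else 0)"
  by (simp add: axis_def)

lemma add_axis_zero: "(x :: complex ^ 'n) + axis j 0 = x"
  by (simp add: vec_eq_iff axis_def)

lemma polyfun_has_partial_derivatives: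
  fixes f :: "complex ^ 'n \<Rightarrow> complex"
  assumes "f \<in> polyfuns"
  shows "\<exists>g\<in>polyfuns. \<forall>x. ((\<lambda>t. f (x + axis j t)) has_field_derivative g x) (at 0)"
  using assms
proof induction
  case (const c)
  show ?case by (rule bexI[OF _ polyfuns.const[of 0]]) simp
next
  case (coord i)
  have "((\<lambda>t. (x + axis j t) $ i) has_field_derivative (if i = j then 1 else 0)) (at 0)"
    for x :: "complex ^ 'n"
    unfolding axis_shift_component by (auto intro!: derivative_eq_intros)
  then show ?case by (intro bexI[OF _ polyfuns.const]) blast
next
  case (add f g)
  then obtain f' g' where "f' \<in> polyfuns" "g' \<in> polyfuns"
    "\<And>x. ((\<lambda>t. f (x + axis j t)) has_field_derivative f' x) (at 0)"
    "\<And>x. ((\<lambda>t. g (x + axis j t)) has_field_derivative g' x) (at 0)" by blast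
  then show ?case by (intro bexI[OF _ polyfuns.add[of f' g']]) (auto intro!: DERIV_add)
next
  case (mult f g)
  then obtain f' g' where fg: "f' \<in> polyfuns" "g' \<in> polyfuns"
    "\<And>x. ((\<lambda>t. f (x + axis j t)) has_field_derivative f' x) (at 0)"
    "\<And>x. ((\<lambda>t. g (x + axis j t)) has_field_derivative g' x) (at 0)" by blast
  have "((\<lambda>t. f (x + axis j t) * g (x + axis j t)) has_field_derivative
    f' x * g x + g' x * f x) (at 0)" for x
    using DERIV_mult[OF fg(3)[of x] fg(4)[of x]] by (simp add: add_axis_zero)
  then show ?case
    using mult fg by (intro bexI[of _ "\<lambda>x. f' x * g x + g' x * f x"] polyfuns.intros) auto
qed

lemma polyfun_gradient_has_derivative:
  assumes "f \<in> polyfuns"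
  shows "((\<lambda>t. f (x + axis j t)) has_field_derivative gradient f x $ j) (at 0)"
  using polyfun_has_partial_derivatives[OF assms, of j] DERIV_imp_deriv
  unfolding gradient_def by (metis vec_lambda_beta)

lemma gradient_eqI:
  assumes "\<And>j. ((\<lambda>t. f (x + axis j t)) has_field_derivative v $ j) (at 0)"
  shows "gradient f x = v"
  unfolding gradient_def vec_eq_iff using DERIV_imp_deriv[OF assms] by simp

lemma gradient_in_polyfuns:
  assumes "f \<in> polyfuns" shows "(\<lambda>x. gradient f x $ j) \<in> polyfuns"
proof -
  obtain g where g: "g \<in> polyfuns" "\<And>x. ((\<lambda>t. f (x + axis j t)) has_field_derivative g x) (at 0)"
    using polyfun_has_partial_derivatives[OF assms] by blast
  have "gradient f x $ j = g x" for x
    using DERIV_unique[OF g(2) polyfun_gradient_has_derivative[OF assms]] by simp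
  then show ?thesis using g(1) by simp
qed

lemma gradient_const: "gradient (\<lambda>x. c) x = 0"
  by (rule gradient_eqI) simp

lemma gradient_coord: "gradient (\<lambda>x. x $ i) x = axis i 1"
  by (rule gradient_eqI, unfold axis_shift_component) (auto intro!: derivative_eq_intros simp: axis_def)

lemma gradient_add:
  assumes "f \<in> polyfuns" "g \<in> polyfuns"
  shows "gradient (\<lambda>x. f x + g x) x = gradient f x + gradient g x"
  by (rule gradient_eqI)
    (use assms in \<open>auto intro!: DERIV_add polyfun_gradient_has_derivative\<close>)

lemma gradient_mult:
  assumes "f \<in> polyfuns" "g \<in> polyfuns"
  shows "gradient (\<lambda>x. f x * g x) x = f x *s gradient g x + g x *s gradient f x"
proof (rule gradient_eqI)
  fix j
  show "((\<lambda>t. f (x + axis j t) * g (x + axis j t)) has_field_derivative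
    (f x *s gradient g x + g x *s gradient f x) $ j) (at 0)"
    using DERIV_mult[OF polyfun_gradient_has_derivative[OF assms(1), of x j]
        polyfun_gradient_has_derivative[OF assms(2), of x j]]
    by (simp add: add_axis_zero algebra_simps)
qed

definition linear_form :: "complex ^ 'n \<Rightarrow> complex ^ 'n \<Rightarrow> complex" where
  "linear_form w x = (\<Sum>j\<in>UNIV. w $ j * x $ j)"

lemma linear_form_in_polyfuns: "linear_form w \<in> polyfuns"
  unfolding linear_form_def[abs_def] by (intro polyfuns_sum polyfuns.intros) auto

lemma gradient_linear_form: "gradient (linear_form w) x = w"
proof (rule gradient_eqI)
  fix j
  have "((\<lambda>t. linear_form w x + w $ j * t) has_field_derivative w $ j) (at 0)"
    by (auto intro!: derivative_eq_intros)
  also have "(\<lambda>t. linear_form w x + w $ j * t) = (\<lambda>t. linear_form w (x + axis j t))"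
    unfolding linear_form_def axis_shift_component
    by (simp add: fun_eq_iff distrib_left sum.distrib if_distrib[of "\<lambda>z. _ * z"] cong: if_cong)
  finally show "((\<lambda>t. linear_form w (x + axis j t)) has_field_derivative w $ j) (at 0)" .
qed

lemma vector_field_chain_rule:
  assumes X: "X \<in> vector_fields U" and f: "f \<in> polyfuns"
  shows "X (restr U f) x = (\<Sum>j\<in>UNIV. gradient f x $ j * X (restr U (\<lambda>y. y $ j)) x)"
  using f
proof induction
  case (const c)
  then show ?case by (simp add: vector_field_const[OF X] gradient_const)
next
  case (coord i)
  then show ?case by (simp add: gradient_coord axis_def if_distrib[of "\<lambda>z. z * _"] cong: if_cong)
next
  case (add f g)
  then show ?case
    by (simp add: vector_field_restr_add[OF X] gradient_add distrib_right sum.distrib)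
next
  case (mult f g)
  then show ?case
    by (simp add: vector_field_restr_mult[OF X] gradient_mult distrib_right sum.distrib
        sum_distrib_left mult.assoc)
qed

text \<open>
  A derivation of the polynomial ring that maps the ideal of \<open>U\<close> into itself descends to \<open>\<O>(U)\<close>; the
  chosen polynomial representative does not matter then.
\<close>

definition induced_field ::
  "(complex ^ 'n) set \<Rightarrow> ((complex ^ 'n \<Rightarrow> complex) \<Rightarrow> complex ^ 'n \<Rightarrow> complex)
    \<Rightarrow> (complex ^ 'n \<Rightarrow> complex) \<Rightarrow> complex ^ 'n \<Rightarrow> complex" where
  "induced_field U \<Delta> g = (if g \<in> coord_ring U
     then restr U (\<Delta> (SOME f. f \<in> polyfuns \<and> restr U f = g)) else (\<lambda>x. 0))"

locale tangent_derivation =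
  fixes U :: "(complex ^ 'n) set" and \<Delta> :: "(complex ^ 'n \<Rightarrow> complex) \<Rightarrow> complex ^ 'n \<Rightarrow> complex"
  assumes closed: "f \<in> polyfuns \<Longrightarrow> \<Delta> f \<in> polyfuns"
    and const: "\<Delta> (\<lambda>x. c) = (\<lambda>x. 0)"
    and add: "f \<in> polyfuns \<Longrightarrow> g \<in> polyfuns \<Longrightarrow> \<Delta> (\<lambda>x. f x + g x) = (\<lambda>x. \<Delta> f x + \<Delta> g x)"
    and mult: "f \<in> polyfuns \<Longrightarrow> g \<in> polyfuns \<Longrightarrow> \<Delta> (\<lambda>x. f x * g x) = (\<lambda>x. f x * \<Delta> g x + g x * \<Delta> f x)"
    and tangent: "f \<in> vanishing_ideal U \<Longrightarrow> x \<in> U \<Longrightarrow> \<Delta> f x = 0"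
begin

lemma induced_field_restr:
  assumes f: "f \<in> polyfuns"
  shows "induced_field U \<Delta> (restr U f) = restr U (\<Delta> f)"
proof -
  define g where "g = (SOME g. g \<in> polyfuns \<and> restr U g = restr U f)"
  have g: "g \<in> polyfuns \<and> restr U g = restr U f"
    unfolding g_def by (rule someI[of _ f]) (simp add: f)
  have scaled: "(\<lambda>x. (-1) * f x) \<in> polyfuns" by (intro polyfuns.intros f)
  have "g x = f x" if "x \<in> U" for x
    using g that by (auto simp: restr_def fun_eq_iff split: if_splits)
  then have "(\<lambda>x. g x + (-1) * f x) \<in> vanishing_ideal U"
    unfolding vanishing_ideal_def using polyfuns.add[OF _ scaled, of g] g by simp
  from tangent[OF this] have "\<Delta> g x = \<Delta> f x" if "x \<in> U" for x
    using that g f scaled mult[OF polyfuns.const[of "-1"] f] const[of "-1"]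
      add[of g "\<lambda>x. (-1) * f x"] by simp
  then have "restr U (\<Delta> g) = restr U (\<Delta> f)" by (auto simp: restr_def)
  then show ?thesis
    by (simp add: induced_field_def restr_in_coord_ring[OF f] g_def)
qed

lemma induced_field_in_vector_fields: "induced_field U \<Delta> \<in> vector_fields U"
  unfolding vector_fields_def mem_Collect_eq
proof (intro conjI allI impI ballI)
  show "induced_field U \<Delta> f = (\<lambda>x. 0)" if "f \<notin> coord_ring U" for f
    using that by (simp add: induced_field_def)
next
  fix f assume "f \<in> coord_ring U"
  then obtain p where p: "p \<in> polyfuns" "f = restr U p" by (rule coord_ringE)
  show "induced_field U \<Delta> f \<in> coord_ring U"
    unfolding p induced_field_restr[OF p(1)] by (intro restr_in_coord_ring closed p)
  fix c
  have cp: "(\<lambda>x. c * p x) \<in> polyfuns" by (intro polyfuns.intros p)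
  have "(\<lambda>x. c * f x) = restr U (\<lambda>x. c * p x)" by (auto simp: p restr_def)
  then show "induced_field U \<Delta> (\<lambda>x. c * f x) = (\<lambda>x. c * induced_field U \<Delta> f x)"
    unfolding p by (simp add: induced_field_restr cp p mult[OF polyfuns.const p(1)] const)
      (auto simp: restr_def)
next
  fix f g assume "f \<in> coord_ring U" "g \<in> coord_ring U"
  then obtain p q where p: "p \<in> polyfuns" "f = restr U p" and q: "q \<in> polyfuns" "g = restr U q"
    by (meson coord_ringE)
  have *: "(\<lambda>x. f x + g x) = restr U (\<lambda>x. p x + q x)" "(\<lambda>x. f x * g x) = restr U (\<lambda>x. p x * q x)"
    by (auto simp: p q restr_def)
  show "induced_field U \<Delta> (\<lambda>x. f x + g x) = (\<lambda>x. induced_field U \<Delta> f x + induced_field U \<Delta> g x)"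
    unfolding *(1) induced_field_restr[OF polyfuns.add[OF p(1) q(1)]] add[OF p(1) q(1)]
    unfolding p(2) q(2) induced_field_restr[OF p(1)] induced_field_restr[OF q(1)]
    by (auto simp: restr_def)
  show "induced_field U \<Delta> (\<lambda>x. f x * g x) = (\<lambda>x. f x * induced_field U \<Delta> g x + g x * induced_field U \<Delta> f x)"
    unfolding *(2) induced_field_restr[OF polyfuns.mult[OF p(1) q(1)]] mult[OF p(1) q(1)]
    unfolding p(2) q(2) induced_field_restr[OF p(1)] induced_field_restr[OF q(1)]
    by (auto simp: restr_def)
qed

end

section \<open>Determinants and Cramer's rule\<close>

definition replace_row :: "'a ^ 'n ^ 'n \<Rightarrow> 'n \<Rightarrow> 'a ^ 'n \<Rightarrow> 'a ^ 'n ^ 'n" where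
  "replace_row A k v = (\<chi> i. if i = k then v else A $ i)"

lemma det_replace_row_0: "det (replace_row A k (0 :: 'a :: comm_ring_1 ^ 'n)) = 0"
  unfolding replace_row_def by (rule det_row_0)

lemma det_replace_row_add:
  "det (replace_row A k (v + w :: 'a :: comm_ring_1 ^ 'n)) = det (replace_row A k v) + det (replace_row A k w)"
  unfolding replace_row_def by (rule det_row_add)

lemma det_replace_row_scale:
  "det (replace_row A k (c *s v :: 'a :: comm_ring_1 ^ 'n)) = c * det (replace_row A k v)"
  unfolding replace_row_def by (rule det_row_mul)

lemma det_in_polyfuns:
  assumes "\<And>i j. (\<lambda>x. A x $ i $ j) \<in> polyfuns"
  shows "(\<lambda>x. det (A x)) \<in> polyfuns"
  unfolding det_def
  by (intro polyfuns_sum polyfuns.mult polyfuns.const polyfuns_prod assms finite_permutations finite)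

text \<open>
  Cramer's rule read as the expansion of \<open>v\<close> in the basis formed by the rows of \<open>A\<close>.
\<close>

lemma cramer_rows:
  fixes A :: "'a :: field ^ 'n ^ 'n"
  assumes "det A \<noteq> 0"
  shows "det A *s v = (\<Sum>k\<in>UNIV. det (replace_row A k v) *s A $ k)"
proof -
  have "invertible A" using assms invertible_det_nz by blast
  then obtain B where "B ** A = mat 1" unfolding invertible_def by blast
  define c where "c = v v* B"
  have "v = transpose A *v c"
    unfolding c_def transpose_matrix_vector vector_matrix_mul_assoc \<open>B ** A = mat 1\<close> by simp
  then have c: "v = (\<Sum>i\<in>UNIV. c $ i *s row i A)"
    by (simp only: matrix_mult_sum column_transpose)
  have "det (replace_row A k v) = c $ k * det A" for k
    using cramer_lemma_transpose[of k c A]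
    by (simp add: replace_row_def c row_def vec_lambda_eta cong: if_cong)
  then have "(\<Sum>k\<in>UNIV. det (replace_row A k v) *s A $ k) = (\<Sum>k\<in>UNIV. det A *s (c $ k *s row k A))"
    by (simp add: row_def vec_lambda_eta mult.commute)
  also have "\<dots> = det A *s v" unfolding c by (simp add: vec.scale_sum_right)
  finally show ?thesis by simp
qed

lemma det_eq_0_if_rows_in_small_space:
  fixes A :: "'a :: field ^ 'n ^ 'n"
  assumes "(\<lambda>i. A $ i) ` S \<subseteq> V" "vec.dim V < card S"
  shows "det A = 0"
proof (rule ccontr)
  assume nz: "det A \<noteq> 0"
  have row: "row i A = A $ i" for i by (simp add: row_def vec_lambda_eta)
  have "inj_on (\<lambda>i. A $ i) S"
    using det_identical_rows[of _ _ A] nz unfolding row by (meson inj_onI)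
  then have "card ((\<lambda>i. A $ i) ` S) = card S" by (rule card_image)
  moreover have "vec.independent (rows A)" using det_dependent_rows nz by blast
  then have "vec.independent ((\<lambda>i. A $ i) ` S)"
    by (rule vec.independent_mono) (auto simp: rows_def row)
  ultimately show False
    using vec.independent_card_le_dim[OF assms(1)] assms(2) by simp
qed

section \<open>Local frames and finite generation\<close>

lemma square_span_mono: "T \<subseteq> T' \<Longrightarrow> square_span U T \<subseteq> square_span U T'"
proof
  fix X assume "X \<in> square_span U T" "T \<subseteq> T'"
  then show "X \<in> square_span U T'"
    by (induction) (auto intro: square_span.intros)
qed

lemma square_span_times:
  assumes "X \<in> square_span U T" and g: "g \<in> polyfuns"
  shows "(\<lambda>f x. g x * X f x) \<in> square_span U T"
  using assms(1)
proof induction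
  case zero
  show ?case using square_span.zero by simp
next
  case (add X Y)
  show ?case using square_span.add[OF add.IH] by (simp add: distrib_left)
next
  case (square P a h)
  show ?case using square_span.square[OF square(1) polyfuns.mult[OF g square(2)]] by (simp add: mult.assoc)
qed

lemma square_span_sum:
  assumes "finite K" "\<And>k. k \<in> K \<Longrightarrow> X k \<in> square_span U T"
  shows "(\<lambda>f x. \<Sum>k\<in>K. X k f x) \<in> square_span U T"
  using assms
proof (induction K rule: finite_induct)
  case empty
  show ?case using square_span.zero by simp
next
  case (insert k K)
  then have "(\<lambda>f x. X k f x + (\<Sum>k\<in>K. X k f x)) \<in> square_span U T"
    by (intro square_span.add) auto
  then show ?case using insert by simp
qed

lemma vanishing_ideal_restr: "f \<in> vanishing_ideal U \<Longrightarrow> restr U f = (\<lambda>x. 0)"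
  by (auto simp: vanishing_ideal_def restr_def)

text \<open>
  A basis of the row space of the Jacobian at \<open>p\<close>, made of gradients of equations \<open>F i\<close> of \<open>U\<close>, is
  completed by constant vectors to a basis of \<open>\<complex>\<^sup>n\<close>. All rows are indexed by the coordinate type, so that
  square determinants of size \<open>n\<close> can replace minors.
\<close>

lemma adapted_frame:
  fixes p :: "complex ^ 'n"
  shows "\<exists>R F w. card R = jacobian_rank U p \<and> (\<forall>i\<in>R. F i \<in> vanishing_ideal U) \<and>
    det (\<chi> i. if i \<in> R then gradient (F i) p else w i) \<noteq> 0"
proof -
  let ?G = "(\<lambda>f. gradient f p) ` vanishing_ideal U"
  obtain B where B: "B \<subseteq> ?G" "vec.independent B" "card B = jacobian_rank U p"
    unfolding jacobian_rank_def using vec.basis_exists by metis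
  let ?E = "vec.extend_basis B"
  have E: "B \<subseteq> ?E" "vec.independent ?E" "vec.span ?E = UNIV"
    using vec.extend_basis_superset vec.independent_extend_basis vec.span_extend_basis B(2) by blast+
  have "card ?E = CARD('n)"
    using vec.dim_eq_card[of ?E UNIV] E(2,3) unfolding vec_dim_card by simp
  moreover have "finite ?E" using vec.finiteI_independent E(2) by blast
  ultimately obtain e :: "'n \<Rightarrow> complex ^ 'n" where e: "bij_betw e UNIV ?E"
    using finite_same_card_bij[of "UNIV :: 'n set" ?E] by auto
  define R where "R = {i. e i \<in> B}"
  have "\<exists>f\<in>vanishing_ideal U. gradient f p = e i" if "i \<in> R" for i
    using that B(1) unfolding R_def by force
  then obtain F where F: "\<And>i. i \<in> R \<Longrightarrow> F i \<in> vanishing_ideal U \<and> gradient (F i) p = e i" by metis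
  have "bij_betw e R B"
    using e E(1) unfolding bij_betw_def R_def by (auto simp: inj_on_def)
  then have "card R = jacobian_rank U p" using B(3) bij_betw_same_card by metis
  moreover have "(\<chi> i. if i \<in> R then gradient (F i) p else e i) = (\<chi> i. e i)"
    using F by (simp add: vec_eq_iff)
  moreover have "rows (\<chi> i. e i) = ?E"
    using e by (auto simp: rows_def row_def vec_lambda_eta bij_betw_def)
  then have "invertible (\<chi> i. e i)"
    using matrix_left_invertible_span_rows_gen[of "\<chi> i. e i"] E(3) invertible_left_inverse by metis
  then have "det (\<chi> i. e i) \<noteq> 0" using invertible_det_nz by blast
  ultimately show ?thesis using F by (intro exI[of _ R] exI[of _ F] exI[of _ e]) auto
qed

text \<open>
  Let \<open>A(x)\<close> have the rows \<open>grad F\<^sub>i(x)\<close> for \<open>i \<in> R\<close> and the constant rows \<open>w\<^sub>k\<close> for \<open>k \<notin> R\<close>, and let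
  \<open>\<delta> = det A\<close>. Replacing row \<open>k \<notin> R\<close> by \<open>grad f\<close> and taking the determinant is a derivation in \<open>f\<close>. It maps
  equations of \<open>U\<close> to equations of \<open>U\<close>, because on \<open>U\<close> the \<open>r + 1\<close> gradients in the matrix lie in a space of
  dimension \<open>r\<close>; this is where the rank has to be constant. The resulting fields \<open>P\<^sub>k\<close> satisfy \<open>P\<^sub>k(a\<^sub>k) = \<delta>\<close> for
  the linear form \<open>a\<^sub>k\<close> with coefficients \<open>w\<^sub>k\<close>. A vector field \<open>X\<close> kills the \<open>F\<^sub>i\<close>, so Cramer's rule
  gives \<open>\<delta> X = \<Sum> X(a\<^sub>k) P\<^sub>k\<close> where \<open>\<delta> \<noteq> 0\<close>. Multiplied by \<open>\<delta>\<close> this becomes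
  \<open>\<delta>\<^sup>2 X = \<Sum> X(a\<^sub>k) P\<^sub>k(a\<^sub>k) P\<^sub>k\<close>, which holds everywhere.
\<close>

lemma local_square_span:
  fixes U :: "(complex ^ 'n) set"
  assumes rank: "\<And>x. x \<in> U \<Longrightarrow> jacobian_rank U x = r" and p: "p \<in> U"
  shows "\<exists>g\<in>polyfuns. g p \<noteq> 0 \<and> (\<exists>T. finite T \<and> (\<forall>(P, a)\<in>T. P \<in> vector_fields U \<and> a \<in> polyfuns) \<and>
    (\<forall>X\<in>vector_fields U. (\<lambda>f x. g x * X f x) \<in> square_span U T))"
proof -
  obtain R :: "'n set" and F w where R: "card R = r" and F: "\<And>i. i \<in> R \<Longrightarrow> F i \<in> vanishing_ideal U"
    and nz: "det (\<chi> i. if i \<in> R then gradient (F i) p else w i) \<noteq> 0"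
    using adapted_frame[of U p] rank[OF p] by auto
  define A where "A x = (\<chi> i. if i \<in> R then gradient (F i) x else w i)" for x
  define \<delta> where "\<delta> x = det (A x)" for x
  define \<Delta> where "\<Delta> k f x = det (replace_row (A x) k (gradient f x))" for k f x
  have F_poly: "F i \<in> polyfuns" if "i \<in> R" for i
    using F[OF that] by (simp add: vanishing_ideal_def)
  have A_poly: "(\<lambda>x. A x $ i $ j) \<in> polyfuns" for i j
    unfolding A_def by (cases "i \<in> R") (auto intro: gradient_in_polyfuns F_poly polyfuns.const)
  have \<delta>_poly: "\<delta> \<in> polyfuns"
    unfolding \<delta>_def[abs_def] by (intro det_in_polyfuns A_poly)
  have derivation: "tangent_derivation U (\<Delta> k)" if k: "k \<notin> R" for k
  proof
    fix f :: "complex ^ 'n \<Rightarrow> complex" assume f: "f \<in> polyfuns"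
    have "(\<lambda>x. replace_row (A x) k (gradient f x) $ i $ j) \<in> polyfuns" for i j
      unfolding replace_row_def by (cases "i = k") (auto intro: gradient_in_polyfuns f A_poly)
    then show "\<Delta> k f \<in> polyfuns"
      unfolding \<Delta>_def[abs_def] by (rule det_in_polyfuns)
  next
    show "\<Delta> k (\<lambda>x. c) = (\<lambda>x. 0)" for c
      unfolding \<Delta>_def[abs_def] gradient_const by (simp add: det_replace_row_0)
  next
    fix f g :: "complex ^ 'n \<Rightarrow> complex" assume "f \<in> polyfuns" "g \<in> polyfuns"
    then show "\<Delta> k (\<lambda>x. f x + g x) = (\<lambda>x. \<Delta> k f x + \<Delta> k g x)"
      "\<Delta> k (\<lambda>x. f x * g x) = (\<lambda>x. f x * \<Delta> k g x + g x * \<Delta> k f x)"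
      unfolding \<Delta>_def[abs_def]
      by (simp_all add: gradient_add gradient_mult det_replace_row_add det_replace_row_scale)
  next
    fix f x assume f: "f \<in> vanishing_ideal U" and x: "x \<in> U"
    have "(\<lambda>i. replace_row (A x) k (gradient f x) $ i) ` insert k R
      \<subseteq> (\<lambda>f. gradient f x) ` vanishing_ideal U"
      using f F k by (auto simp: replace_row_def A_def)
    then show "\<Delta> k f x = 0"
      unfolding \<Delta>_def using rank[OF x, unfolded jacobian_rank_def] R k
      by (intro det_eq_0_if_rows_in_small_space[of _ "insert k R"]) auto
  qed
  define P where "P k = induced_field U (\<Delta> k)" for k
  have P: "P k \<in> vector_fields U" if "k \<notin> R" for k
    unfolding P_def by (rule tangent_derivation.induced_field_in_vector_fields[OF derivation[OF that]])
  have P_restr: "P k (restr U f) = restr U (\<Delta> k f)" if "k \<notin> R" "f \<in> polyfuns" for k f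
    unfolding P_def by (rule tangent_derivation.induced_field_restr[OF derivation[OF that(1)] that(2)])
  have dual: "P k (restr U (linear_form (w k))) = restr U \<delta>" if k: "k \<notin> R" for k
  proof -
    have "replace_row (A x) k (w k) = A x" for x
      using k by (simp add: replace_row_def A_def vec_eq_iff)
    then have "\<Delta> k (linear_form (w k)) = \<delta>"
      by (simp add: \<Delta>_def \<delta>_def fun_eq_iff gradient_linear_form)
    then show ?thesis by (simp add: P_restr[OF k linear_form_in_polyfuns])
  qed
  define T where "T = (\<lambda>k. (P k, linear_form (w k))) ` (- R)"
  have T: "(\<lambda>f x. \<delta> x ^ 2 * X f x) \<in> square_span U T" if X: "X \<in> vector_fields U" for X
  proof -
    have "\<exists>h\<in>polyfuns. X (restr U (linear_form (w k))) = restr U h" for k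
      using vector_fields_D(2)[OF X restr_in_coord_ring[OF linear_form_in_polyfuns]] by (meson coord_ringE)
    then obtain h where h: "\<And>k. h k \<in> polyfuns" "\<And>k. X (restr U (linear_form (w k))) = restr U (h k)"
      by metis
    have "\<delta> x ^ 2 * X f x = (\<Sum>k\<in>-R. h k x * (P k (restr U (linear_form (w k))) x * P k f x))" for f x
    proof (cases "x \<in> U \<and> f \<in> coord_ring U")
      case False
      then have "X f x = 0" "\<And>k. k \<notin> R \<Longrightarrow> P k f x = 0"
        using vector_field_outside[OF X] vector_field_outside[OF P] vector_fields_D(1)[OF X]
          vector_fields_D(1)[OF P] by auto
      then show ?thesis by simp
    next
      case True
      then obtain q where q: "q \<in> polyfuns" "f = restr U q" and x: "x \<in> U" by (meson coord_ringE)
      \<comment> \<open>The tangent vector of \<open>X\<close> at \<open>x\<close>, as a linear form on gradients.\<close>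
      define \<phi> where "\<phi> v = (\<Sum>j\<in>UNIV. v $ j * X (restr U (\<lambda>y. y $ j)) x)" for v
      have chain: "X (restr U f) x = \<phi> (gradient f x)" if "f \<in> polyfuns" for f
        unfolding \<phi>_def by (rule vector_field_chain_rule[OF X that])
      have \<phi>_scale: "\<phi> (c *s v) = c * \<phi> v" for c v
        by (simp add: \<phi>_def sum_distrib_left mult.assoc)
      have \<phi>_sum: "\<phi> (\<Sum>k\<in>K. v k) = (\<Sum>k\<in>K. \<phi> (v k))" for K :: "'n set" and v
        unfolding \<phi>_def by (subst sum.swap) (simp add: sum_distrib_right)
      have "\<phi> (A x $ k) = (if k \<in> R then 0 else h k x)" for k
      proof (cases "k \<in> R")
        case True
        then show ?thesis
          using chain[OF F_poly[OF True]] vanishing_ideal_restr[OF F[OF True]] vector_fields_zero[OF X]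
          by (simp add: A_def)
      next
        case False
        then show ?thesis
          using chain[OF linear_form_in_polyfuns, of "w k"] x
          unfolding h(2) gradient_linear_form by (simp add: A_def False restr_def)
      qed
      note \<phi>_row = this
      \<comment> \<open>The rows of \<open>A x\<close> need not span where \<open>\<delta>\<close> vanishes, but there both sides are 0.\<close>
      show ?thesis
      proof (cases "\<delta> x = 0")
        case True
        then have "P k (restr U (linear_form (w k))) x = 0" if "k \<notin> R" for k
          unfolding dual[OF that] by (simp add: restr_def)
        then show ?thesis using True by simp
      next
        case False
        have "\<delta> x * X f x = \<phi> (det (A x) *s gradient q x)"
          unfolding q chain[OF q(1)] \<phi>_scale \<delta>_def ..
        also have "\<dots> = (\<Sum>k\<in>UNIV. \<Delta> k q x * \<phi> (A x $ k))"
          using False unfolding \<delta>_def by (simp add: cramer_rows \<phi>_sum \<phi>_scale \<Delta>_def)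
        also have "\<dots> = (\<Sum>k\<in>-R. \<Delta> k q x * h k x)"
          by (intro sum.mono_neutral_cong_right) (auto simp: \<phi>_row)
        finally have "\<delta> x ^ 2 * X f x = (\<Sum>k\<in>-R. h k x * (\<delta> x * \<Delta> k q x))"
          by (simp add: power2_eq_square sum_distrib_left mult_ac)
        moreover have "P k (restr U (linear_form (w k))) x * P k f x = \<delta> x * \<Delta> k q x" if "k \<notin> R" for k
          unfolding dual[OF that] q(2) P_restr[OF that q(1)] using x by (simp add: restr_def)
        ultimately show ?thesis by simp
      qed
    qed
    then have "(\<lambda>f x. \<delta> x ^ 2 * X f x)
      = (\<lambda>f x. \<Sum>k\<in>-R. h k x * (P k (restr U (linear_form (w k))) x * P k f x))"
      by blast
    also have "\<dots> \<in> square_span U T"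
      using h(1) by (intro square_span_sum square_span.square) (auto simp: T_def)
    finally show ?thesis .
  qed
  have "(\<lambda>x. \<delta> x ^ 2) \<in> polyfuns"
    unfolding power2_eq_square by (intro polyfuns.mult \<delta>_poly)
  moreover have "\<delta> p ^ 2 \<noteq> 0" using nz by (simp add: \<delta>_def A_def)
  moreover have "finite T" "\<forall>(P, a)\<in>T. P \<in> vector_fields U \<and> a \<in> polyfuns"
    using P linear_form_in_polyfuns by (auto simp: T_def)
  ultimately show ?thesis using T by (intro bexI[of _ "\<lambda>x. \<delta> x ^ 2"] conjI exI[of _ T]) auto
qed

text \<open>
  The functions \<open>g\<close> for which \<open>g X\<close> lies, for all vector fields \<open>X\<close>, in the module of one finite \<open>T\<close> form an ideal.
  It contains the equations of \<open>U\<close>, which act as zero, and a function that does not vanish at any given point of \<open>U\<close>.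
  Thus it has no common zero.
\<close>

lemma global_square_span:
  fixes U :: "(complex ^ 'n) set"
  assumes closed: "zariski_closed U" and rank: "\<And>x. x \<in> U \<Longrightarrow> jacobian_rank U x = r"
  shows "\<exists>T. finite T \<and> (\<forall>(P, a)\<in>T. P \<in> vector_fields U \<and> a \<in> polyfuns) \<and>
    vector_fields U \<subseteq> square_span U T"
proof -
  define spans where "spans g T \<longleftrightarrow> finite T \<and> (\<forall>(P, a)\<in>T. P \<in> vector_fields U \<and> a \<in> polyfuns) \<and>
    (\<forall>X\<in>vector_fields U. (\<lambda>f x. g x * X f x) \<in> square_span U T)" for g T
  define J where "J = {g \<in> polyfuns. \<exists>T. spans g T}"
  have zero: "spans g {}" if "\<And>x. x \<in> U \<Longrightarrow> g x = 0" for g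
  proof -
    have "(\<lambda>f x. g x * X f x) = (\<lambda>f x. 0)" if "X \<in> vector_fields U" for X
      using vector_field_outside[OF that] \<open>\<And>x. x \<in> U \<Longrightarrow> g x = 0\<close>
      by (metis mult_eq_0_iff)
    then show ?thesis unfolding spans_def using square_span.zero by auto
  qed
  have "polyfun_ideal J"
    unfolding polyfun_ideal_def
  proof (intro conjI ballI)
    show "J \<subseteq> polyfuns" by (auto simp: J_def)
    show "(\<lambda>x. 0) \<in> J" unfolding J_def using zero[of "\<lambda>x. 0"] polyfuns.const by blast
  next
    fix g g' assume "g \<in> J" "g' \<in> J"
    then obtain T T' where g: "g \<in> polyfuns" "g' \<in> polyfuns" "spans g T" "spans g' T'"
      unfolding J_def by blast
    have "spans (\<lambda>x. g x + g' x) (T \<union> T')"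
      unfolding spans_def
    proof (intro conjI ballI)
      fix X assume X: "X \<in> vector_fields U"
      have "(\<lambda>f x. g x * X f x) \<in> square_span U (T \<union> T')" "(\<lambda>f x. g' x * X f x) \<in> square_span U (T \<union> T')"
        using g(3,4) X square_span_mono[of T "T \<union> T'" U] square_span_mono[of T' "T \<union> T'" U]
        unfolding spans_def by blast+
      from square_span.add[OF this]
      show "(\<lambda>f x. (g x + g' x) * X f x) \<in> square_span U (T \<union> T')" by (simp add: distrib_right)
    qed (use g(3,4) in \<open>auto simp: spans_def\<close>)
    then show "(\<lambda>x. g x + g' x) \<in> J" unfolding J_def using polyfuns.add[OF g(1,2)] by blast
  next
    fix h g :: "complex ^ 'n \<Rightarrow> complex" assume h: "h \<in> polyfuns" and "g \<in> J"
    then obtain T where g: "g \<in> polyfuns" "spans g T" unfolding J_def by blast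
    have "spans (\<lambda>x. h x * g x) T"
      using g(2) square_span_times[OF _ h] unfolding spans_def by (auto simp: mult.assoc)
    then show "(\<lambda>x. h x * g x) \<in> J" unfolding J_def using polyfuns.mult[OF h g(1)] by blast
  qed
  moreover have "\<exists>g\<in>J. g p \<noteq> 0" for p
  proof (cases "p \<in> U")
    case True
    from local_square_span[OF rank this] show ?thesis unfolding J_def spans_def by blast
  next
    case False
    obtain F where F: "F \<subseteq> polyfuns" "U = {x. \<forall>f\<in>F. f x = 0}"
      using closed unfolding zariski_closed_def by blast
    then obtain f where f: "f \<in> F" "f p \<noteq> 0" using False by blast
    then have "spans f {}" using F(2) by (intro zero) blast
    then show ?thesis using f F(1) unfolding J_def by blast
  qed
  ultimately have "(\<lambda>x. 1) \<in> J" by (rule weak_Nullstellensatz)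
  then obtain T where "spans (\<lambda>x. 1) T" unfolding J_def by blast
  then show ?thesis unfolding spans_def by (intro exI[of _ T]) auto
qed

theorem theorem1p1:
  fixes U :: "(complex ^ 'n) set"
  assumes "affine_variety U" and "smooth_variety U"
  shows "finitely_generated_lie (vector_fields U)"
proof -
  have closed: "zariski_closed U"
    using assms(1) unfolding affine_variety_def irreducible_closed_def by blast
  have "jacobian_rank U x = jacobian_rank U y" if "x \<in> U" "y \<in> U" for x y
  proof -
    have "enat (jacobian_rank U x) + zariski_dim U = enat CARD('n)"
      "enat (jacobian_rank U y) + zariski_dim U = enat CARD('n)"
      using assms(2) that unfolding smooth_variety_def by auto
    then show ?thesis by (cases "zariski_dim U") auto
  qed
  then obtain r where "\<And>x. x \<in> U \<Longrightarrow> jacobian_rank U x = r" by metis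
  from global_square_span[OF closed this] obtain T where "finite T"
    "\<forall>(P, a)\<in>T. P \<in> vector_fields U \<and> a \<in> polyfuns" "vector_fields U \<subseteq> square_span U T" by blast
  then show ?thesis by (intro finitely_generated_if_square_span[of T U]) auto
qed

end
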